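(* Let $n$ agents run the decentralized online Mirror Descent updates described in the context over a finite horizon $T$, in order to track a target $x^\star_t\in\mathbb{R}^d$ obeying $x^\star_{t+1}=Ax^\star_t+v_t$, $t\in\{1,\dots,T\}$, with known matrix $A\in\mathbb{R}^{d\times d}$ and adversarial noise $v_t$ (no statistical assumption on $\{v_t\}$), where $x^\star_t$ is a minimizer over $\mathcal{X}$ of the global loss $f_t=\frac1n\sum_{i=1}^n f_{i,t}$. Let $\mathbf{x}_{i,t}$ be the estimate of agent $i$ at time $t$, generated by these updates with stochastic gradients satisfying $\mathbb{E}[\boldsymbol{\nabla}_{i,t}\mid\mathcal{F}_{t-1}]=\nabla f_{i,t}(\mathbf{x}_{i,t})$ and $\|\boldsymbol{\nabla}_{i,t}\|_*\le L$. Suppose Assumptions (1)-(5) listed in the context hold. Then for every $\delta\in(0,1)$, with probability at least $1-\delta$, the dynamic regret $$\mathrm{Reg}^d_T:=\frac1n\sum_{i=1}^n\sum_{t=1}^T f_t(\mathbf{x}_{i,t})-\sum_{t=1}^T f_t(x^\star_t)$$ satisfies $$\mathrm{Reg}^d_T\le E_{\mathrm{Track}}+E_{\mathrm{Net}}+E_{\mathrm{Stoch}},$$ where $$E_{\mathrm{Track}}:=\frac{2R^2}{\eta_{T+1}}+\sum_{t=1}^T\frac{K}{\eta_{t+1}}\,\|x^\star_{t+1}-Ax^\star_t\|+L^2\sum_{t=1}^T\frac{\eta_t}{2},$$ $$E_{\mathrm{Net}}:=4L^2\sqrt{n}\sum_{t=1}^T\sum_{\tau=0}^{t-1}\eta_\tau\,\sigma_2(W)^{t-\tau-1},$$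 $$E_{\mathrm{Stoch}}:=8LR\sqrt{-T\log\delta},$$ and $R^2:=\sup_{x,y\in\mathcal{X}}\mathcal{D}_{\mathcal{R}}(x,y)$ (with $R\ge 0$).
   Context: **Domain and Bregman divergence.** $\mathcal{X}\subset\mathbb{R}^d$ is a convex compact set, $\|\cdot\|$ is a norm on $\mathbb{R}^d$ and $\|\cdot\|_*$ is its dual norm. $\mathcal{R}:\mathcal{X}\to\mathbb{R}$ is a (differentiable) function that is 1-strongly convex with respect to $\|\cdot\|$: $\mathcal{R}(x)\ge\mathcal{R}(y)+\langle\nabla\mathcal{R}(y),x-y\rangle+\frac12\|x-y\|^2$ for all $x,y\in\mathcal{X}$. Its Bregman divergence is $\mathcal{D}_{\mathcal{R}}(x,y):=\mathcal{R}(x)-\mathcal{R}(y)-\langle x-y,\nabla\mathcal{R}(y)\rangle$. **Losses and target.** For each agent $i\in\{1,\dots,n\}$ and each time $t$, $f_{i,t}:\mathcal{X}\to\mathbb{R}$ is a (differentiable) convex local loss; the global loss is $f_t(x):=\frac1n\sum_{i=1}^n f_{i,t}(x)$, and $x^\star_t\in\arg\min_{x\in\mathcal{X}}f_t(x)$ is the target location at time $t$. The points $x^\star_1,\dots,x^\star_{T+1}$ lie in $\mathcal{X}$, and $v_t=x^\star_{t+1}-Ax^\star_t$. **Network.** The agents form an undirected graph on vertex set $\{1,\dots,n\}$, with a nonnegative weight matrix $W\in\mathbb{R}^{n\times n}$; for $i\ne j$, $[W]_{ij}>0$ exactly when $i$ and $j$ are neighbors. $\sigma_2(W)$ is the second largest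 eigenvalue of $W$ in magnitude (i.e. the second largest absolute value of an eigenvalue, counted with multiplicity). The convention $0^0=1$ is used. **Stochastic gradients.** $\mathcal{F}_t$ is the $\sigma$-field containing all information prior to the outset of round $t+1$; in particular $\mathbf{x}_{i,t}$, $f_{i,t}$ and $x^\star_t$ are $\mathcal{F}_{t-1}$-measurable (for instance the losses and the target may be arbitrary deterministic sequences). At time $t$ agent $i$ receives a random vector $\boldsymbol{\nabla}_{i,t}$ with $\mathbb{E}[\boldsymbol{\nabla}_{i,t}\mid\mathcal{F}_{t-1}]=\nabla f_{i,t}(\mathbf{x}_{i,t})$ and $\|\boldsymbol{\nabla}_{i,t}\|_*\le L$, where $L$ is the same constant as in Assumption (1). **Algorithm.** Let $\{\eta_t\}_{t\ge0}$ be a positive, non-increasing step-size sequence. The estimates are initialized by $\mathbf{x}_{i,1}=0$ for all $i$, and for each $t\ge 1$ and each $i$, $$\mathbf{y}_{i,t}=\sum_{j=1}^n[W]_{ij}\mathbf{x}_{j,t},\qquad \hat{\mathbf{x}}_{i,t+1}=\arg\min_{x\in\mathcal{X}}\big\{\eta_t\langle x,\boldsymbol{\nabla}_{i,t}\rangle+\mathcal{D}_{\mathcal{R}}(x,\mathbf{y}_{i,t})\big\},\qquad \mathbf{x}_{i,t+1}=A\hat{\mathbf{x}}_{i,t+1}.$$ All iterates lie in $\mathcal{X}$ (with $0\in\mathcal{X}$ and $A\mathcal{X}\subseteq\mathcal{X}$). **Assumptions.** (1) Every $f_{i,t}$ is Lipschitz on $\mathcal{X}$ with a uniform constant $L$: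 $|f_{i,t}(x)-f_{i,t}(y)|\le L\|x-y\|$ for all $x,y\in\mathcal{X}$. (2) The graph is connected, and $W$ is symmetric and doubly stochastic ($\sum_i[W]_{ij}=\sum_j[W]_{ij}=1$) with positive diagonal. (3) Separate convexity: $\mathcal{D}_{\mathcal{R}}\big(x,\sum_{i=1}^n\alpha(i)y_i\big)\le\sum_{i=1}^n\alpha(i)\mathcal{D}_{\mathcal{R}}(x,y_i)$ for all $x,y_1,\dots,y_n\in\mathcal{X}$ and all $\alpha$ in the $n$-dimensional probability simplex. (4) There is a constant $K$ with $|\mathcal{D}_{\mathcal{R}}(x,z)-\mathcal{D}_{\mathcal{R}}(y,z)|\le K\|x-y\|$ for all $x,y,z\in\mathcal{X}$. (5) $A$ is non-expansive: $\mathcal{D}_{\mathcal{R}}(Ax,Ay)\le\mathcal{D}_{\mathcal{R}}(x,y)$ for all $x,y\in\mathcal{X}$, and $\|A\|\le1$ (operator norm induced by $\|\cdot\|$). *)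

theory Defs
  imports
    "HOL-Probability.Probability"
    "HOL-Computational_Algebra.Polynomial"
begin

definition is_norm :: "('a::real_vector \<Rightarrow> real) \<Rightarrow> bool" where
  "is_norm N \<longleftrightarrow>
     (\<forall>x. N x = 0 \<longleftrightarrow> x = 0) \<and>
     (\<forall>c x. N (c *\<^sub>R x) = \<bar>c\<bar> * N x) \<and>
     (\<forall>x y. N (x + y) \<le> N x + N y)"

definition dual_norm :: "('a::real_inner \<Rightarrow> real) \<Rightarrow> 'a \<Rightarrow> real" where
  "dual_norm N z = (SUP x\<in>{x. N x \<le> 1}. x \<bullet> z)"

definition induced_norm :: "(real^'d \<Rightarrow> real) \<Rightarrow> real^'d^'d \<Rightarrow> real" where
  "induced_norm N A = (SUP x\<in>{x. N x \<le> 1}. N (A *v x))"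

text \<open>
  Functions live on \<open>X\<close> only, so derivatives are taken within \<open>X\<close>. If the affine hull of \<open>X\<close> is not
  the whole space, the gradient is determined only up to vectors orthogonal to that hull; \<open>g\<close> is
  then any choice. The Bregman divergence on \<open>X\<close> does not depend on the choice.
\<close>

definition gradient_on :: "'a::real_inner set \<Rightarrow> ('a \<Rightarrow> real) \<Rightarrow> ('a \<Rightarrow> 'a) \<Rightarrow> bool" where
  "gradient_on X f g \<longleftrightarrow> (\<forall>x\<in>X. (f has_derivative (\<lambda>h. g x \<bullet> h)) (at x within X))"

definition bregman :: "('a::real_inner \<Rightarrow> real) \<Rightarrow> ('a \<Rightarrow> 'a) \<Rightarrow> 'a \<Rightarrow> 'a \<Rightarrow> real" where
  "bregman R gR x y = R x - R y - (x - y) \<bullet> gR y"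

definition strongly_convex_wrt ::
  "('a::real_inner \<Rightarrow> real) \<Rightarrow> 'a set \<Rightarrow> ('a \<Rightarrow> real) \<Rightarrow> ('a \<Rightarrow> 'a) \<Rightarrow> bool" where
  "strongly_convex_wrt N X R gR \<longleftrightarrow>
     (\<forall>x\<in>X. \<forall>y\<in>X. R x \<ge> R y + gR y \<bullet> (x - y) + 1/2 * (N (x - y))\<^sup>2)"

definition charpoly :: "real^'n^'n \<Rightarrow> real poly" where
  "charpoly W = det (\<chi> i j. (if i = j then [:0, 1:] else 0) - [:W $ i $ j:])"

text \<open>
  Only real eigenvalues are listed, which is all of them when \<open>W\<close> is symmetric. A \<open>1 \<times> 1\<close> matrix
  has no second eigenvalue; the value is then \<open>0\<close>.
\<close>

definition eigenvalue_magnitudes :: "real^'n^'n \<Rightarrow> real list" where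
  "eigenvalue_magnitudes W =
     rev (sorted_list_of_multiset (image_mset abs (proots (charpoly W))))"

definition sigma2 :: "real^'n^'n \<Rightarrow> real" where
  "sigma2 W =
     (let ls = eigenvalue_magnitudes W in if length ls \<ge> 2 then ls ! 1 else 0)"

definition vec_cond_exp ::
  "'w measure \<Rightarrow> 'w measure \<Rightarrow> ('w \<Rightarrow> real^'d) \<Rightarrow> 'w \<Rightarrow> real^'d" where
  "vec_cond_exp M F g \<omega> = (\<chi> k. real_cond_exp M F (\<lambda>\<omega>'. g \<omega>' $ k) \<omega>)"

definition global_loss :: "('n::finite \<Rightarrow> nat \<Rightarrow> 'a \<Rightarrow> real) \<Rightarrow> nat \<Rightarrow> 'a \<Rightarrow> real" where
  "global_loss f t z = 1 / real CARD('n) * (\<Sum>i\<in>UNIV. f i t z)"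

definition mixed :: "real^'n^'n \<Rightarrow> ('n::finite \<Rightarrow> nat \<Rightarrow> 'a::real_vector) \<Rightarrow> 'n \<Rightarrow> nat \<Rightarrow> 'a" where
  "mixed W x i t = (\<Sum>j\<in>UNIV. (W $ i $ j) *\<^sub>R x j t)"

text \<open>
  One realisation of the algorithm over rounds \<open>1, ..., T\<close>: \<open>g i t\<close> is the gradient received by agent
  \<open>i\<close> in round \<open>t\<close>, \<open>xh\<close> are the mirror steps and \<open>x\<close> the estimates.
\<close>

definition mirror_descent_run ::
  "(real^'d) set \<Rightarrow> (real^'d \<Rightarrow> real) \<Rightarrow> (real^'d \<Rightarrow> real^'d) \<Rightarrow> real^'n^'n \<Rightarrow> real^'d^'d \<Rightarrow>
   (nat \<Rightarrow> real) \<Rightarrow> nat \<Rightarrow> ('n::finite \<Rightarrow> nat \<Rightarrow> real^'d) \<Rightarrow> ('n \<Rightarrow> nat \<Rightarrow> real^'d) \<Rightarrow>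
   ('n \<Rightarrow> nat \<Rightarrow> real^'d) \<Rightarrow> bool" where
  "mirror_descent_run X R gR W A \<eta> T g xh x \<longleftrightarrow>
     (\<forall>i. x i 1 = 0) \<and>
     (\<forall>i. \<forall>t\<in>{1..T}.
        is_arg_min (\<lambda>z. \<eta> t * (z \<bullet> g i t) + bregman R gR z (mixed W x i t))
          (\<lambda>z. z \<in> X) (xh i (t + 1)) \<and>
        x i (t + 1) = A *v xh i (t + 1))"

definition dynamic_regret ::
  "nat \<Rightarrow> ('n::finite \<Rightarrow> nat \<Rightarrow> 'a \<Rightarrow> real) \<Rightarrow> ('n \<Rightarrow> nat \<Rightarrow> 'a) \<Rightarrow> (nat \<Rightarrow> 'a) \<Rightarrow> real" where
  "dynamic_regret T f x xs =
     1 / real CARD('n) * (\<Sum>i\<in>UNIV. \<Sum>t=1..T. global_loss f t (x i t))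
     - (\<Sum>t=1..T. global_loss f t (xs t))"

text \<open>
  In the error terms, \<open>rad\<close> is the square root of the supremum of the Bregman divergence over \<open>X \<times> X\<close>.
\<close>

definition E_track ::
  "(real^'d \<Rightarrow> real) \<Rightarrow> real^'d^'d \<Rightarrow> (nat \<Rightarrow> real) \<Rightarrow> nat \<Rightarrow> real \<Rightarrow> real \<Rightarrow> real \<Rightarrow>
   (nat \<Rightarrow> real^'d) \<Rightarrow> real" where
  "E_track N A \<eta> T L K rad xs =
     2 * rad\<^sup>2 / \<eta> (T + 1)
     + (\<Sum>t=1..T. K / \<eta> (t + 1) * N (xs (t + 1) - A *v xs t))
     + L\<^sup>2 * (\<Sum>t=1..T. \<eta> t / 2)"

definition E_net :: "real^'n^'n \<Rightarrow> (nat \<Rightarrow> real) \<Rightarrow> nat \<Rightarrow> real \<Rightarrow> real" where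
  "E_net W \<eta> T L =
     4 * L\<^sup>2 * sqrt (real CARD('n)) *
     (\<Sum>t=1..T. \<Sum>\<tau>=0..t-1. \<eta> \<tau> * sigma2 W ^ (t - \<tau> - 1))"

definition E_stoch :: "nat \<Rightarrow> real \<Rightarrow> real \<Rightarrow> real \<Rightarrow> real" where
  "E_stoch T L rad \<delta> = 8 * L * rad * sqrt (- real T * ln \<delta>)"

end

theory Submission
  imports Defs
begin

text \<open>
  The proof separates a pathwise inequality from one use of randomness.

  Fix a realisation in which all received gradients have dual norm at most \<open>L\<close>. The local losses are
  Lipschitz and convex, so the regret is at most the average over the agents of the linearised regrets
  \<open>\<nabla>f\<^sub>i\<^sub>,\<^sub>t(x\<^sub>i\<^sub>,\<^sub>t) \<bullet> (x\<^sub>i\<^sub>,\<^sub>t - x\<^sup>\<star>\<^sub>t)\<close> plus a multiple of the distance of the estimates from their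
  average (\<open>global_loss_regret_le\<close>). Replacing the true gradients by the received ones leaves a noise
  term. For the received gradients the three-point inequality of a mirror step
  (\<open>mirror_step_linear_regret\<close>) produces the drop of a potential, the average Bregman divergence of the
  estimates from the target. Mixing does not raise the potential by separate convexity, the known
  dynamics do not raise it because \<open>A\<close> is non-expansive, and the unknown part of the target's motion
  raises it by at most \<open>K\<close> times its norm (\<open>potential_drop\<close>). Weighted by \<open>1 / \<eta>\<^sub>t\<close>, the drops telescope;
  this is the tracking error.

  Disagreement between agents is created by the mirror steps, which move a point by at most \<open>\<eta>\<^sub>t L\<close>, and
  is damped by mixing. On vectors with entry sum \<open>0\<close> the weight matrix contracts by its second largest
  eigenvalue magnitude (\<open>doubly_stochastic_contraction\<close>): the largest magnitude on that subspace
  belongs to an eigenvalue which, by connectivity, is not \<open>1\<close>, and so sits beside the root \<open>1\<close> in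
  the spectrum. Summing the damped displacements gives the network error
  (\<open>balanced_combination_bound\<close>).

  The noise terms are bounded martingale differences, since the estimates and the target are known
  before the gradients arrive. Strong convexity bounds the distance of two points of the domain by
  \<open>\<surd>2\<close> times the radius, and Azuma's inequality (\<open>azuma_centred_quantile\<close>) gives the stochastic error.
\<close>

section \<open>Norms on Euclidean space and their duals\<close>

lemma is_norm_simps:
  assumes "is_norm N"
  shows "N 0 = 0" "N (- x) = N x" "N (c *\<^sub>R x) = \<bar>c\<bar> * N x" "N (x - y) = N (y - x)"
proof -
  show sc: "N (c *\<^sub>R x) = \<bar>c\<bar> * N x" for c x
    using assms unfolding is_norm_def by blast
  show "N 0 = 0" using assms unfolding is_norm_def by blast
  show neg: "N (- x) = N x" for x using sc[of "-1" x] by simp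
  show "N (x - y) = N (y - x)" using neg[of "x - y"] by simp
qed

lemma is_norm_triangle:
  assumes "is_norm N"
  shows "N (x + y) \<le> N x + N y"
  using assms unfolding is_norm_def by blast

lemma is_norm_nonneg:
  assumes "is_norm N"
  shows "0 \<le> N x"
  using is_norm_triangle[OF assms, of x "- x"] is_norm_simps[OF assms] by simp

lemma is_norm_sum_le:
  assumes "is_norm N"
  shows "N (\<Sum>i\<in>I. h i) \<le> (\<Sum>i\<in>I. N (h i))"
proof (induction I rule: infinite_finite_induct)
  case (insert i I)
  then show ?case using is_norm_triangle[OF assms, of "h i" "\<Sum>i\<in>I. h i"] by simp
qed (simp_all add: is_norm_simps[OF assms])

lemma is_norm_le_euclidean:
  fixes N :: "'a::euclidean_space \<Rightarrow> real"
  assumes "is_norm N"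
  obtains C where "\<And>x. N x \<le> C * norm x"
proof
  fix x :: 'a
  have "N x = N (\<Sum>b\<in>Basis. (x \<bullet> b) *\<^sub>R b)" by (simp add: euclidean_representation)
  also have "\<dots> \<le> (\<Sum>b\<in>Basis. \<bar>x \<bullet> b\<bar> * N b)"
    using is_norm_sum_le[OF assms, of "\<lambda>b. (x \<bullet> b) *\<^sub>R b" Basis]
    by (simp add: is_norm_simps[OF assms])
  also have "\<dots> \<le> (\<Sum>b\<in>Basis. norm x * N b)"
    by (intro sum_mono mult_right_mono is_norm_nonneg[OF assms] Basis_le_norm)
  finally show "N x \<le> (\<Sum>b\<in>Basis. N b) * norm x"
    by (simp add: sum_distrib_left mult.commute)
qed

lemma is_norm_continuous:
  fixes N :: "'a::euclidean_space \<Rightarrow> real"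
  assumes "is_norm N"
  shows "continuous_on S N"
proof -
  obtain C where C: "\<And>x. N x \<le> C * norm x" using is_norm_le_euclidean[OF assms] by blast
  have "\<bar>N x - N y\<bar> \<le> N (x - y)" for x y
    using is_norm_triangle[OF assms, of "x - y" y] is_norm_triangle[OF assms, of "y - x" x]
      is_norm_simps(4)[OF assms, of x y] by simp
  then have "dist (N x) (N y) \<le> \<bar>C\<bar> * dist x y" for x y
    unfolding dist_norm real_norm_def
    using C[of "x - y"] by (smt (verit) mult_right_mono norm_ge_zero)
  then have "\<bar>C\<bar>-lipschitz_on S N" by (intro lipschitz_onI) auto
  then show ?thesis by (rule lipschitz_on_continuous_on)
qed

text \<open>Compactness of the Euclidean sphere makes any norm dominate the Euclidean one.\<close>

lemma euclidean_le_is_norm: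
  fixes N :: "'a::euclidean_space \<Rightarrow> real"
  assumes "is_norm N"
  obtains B where "B > 0" "\<And>x. norm x \<le> B * N x"
proof -
  have "sphere (0::'a) 1 \<noteq> {}" using nonempty_Basis norm_Basis by fastforce
  then obtain e :: 'a where e: "norm e = 1" "\<And>x. norm x = 1 \<Longrightarrow> N e \<le> N x"
    using continuous_attains_inf[OF compact_sphere _ is_norm_continuous[OF assms], of 0 1]
    by (auto simp: sphere_def)
  have "N e \<noteq> 0" using e(1) assms unfolding is_norm_def by fastforce
  then have pos: "N e > 0" using is_norm_nonneg[OF assms, of e] by simp
  show thesis
  proof (rule that[of "1 / N e"])
    fix x :: 'a
    show "norm x \<le> 1 / N e * N x"
    proof (cases "x = 0")
      case False
      then have "N e \<le> N ((1 / norm x) *\<^sub>R x)" by (intro e(2)) simp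
      then show ?thesis using False pos by (simp add: is_norm_simps[OF assms] field_simps)
    qed (simp add: is_norm_simps[OF assms])
  qed (use pos in simp)
qed

text \<open>
  The dual norm and the induced norm are suprema over the unit ball of \<open>N\<close>. The ball is bounded in the
  Euclidean norm, so these suprema are finite, and scaling a vector to the ball gives the usual bounds.
\<close>

lemma inner_le_dual_norm:
  fixes N :: "'a::euclidean_space \<Rightarrow> real"
  assumes "is_norm N"
  shows "x \<bullet> z \<le> N x * dual_norm N z"
proof -
  obtain B where B: "B > 0" "\<And>x. norm x \<le> B * N x" using euclidean_le_is_norm[OF assms] by blast
  have bdd: "bdd_above ((\<lambda>x. x \<bullet> z) ` {x. N x \<le> 1})"
  proof (rule bdd_aboveI2)
    fix x assume "x \<in> {x. N x \<le> 1}"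
    then have "B * N x \<le> B * 1" using B(1) by (intro mult_left_mono) auto
    then have "norm x \<le> B" using B(2)[of x] by linarith
    then show "x \<bullet> z \<le> B * norm z"
      using norm_cauchy_schwarz[of x z] mult_right_mono[of "norm x" B "norm z"] by simp
  qed
  show ?thesis
  proof (cases "x = 0")
    case False
    then have pos: "N x > 0" using assms is_norm_nonneg[OF assms, of x]
      unfolding is_norm_def by (metis less_le)
    have "((1 / N x) *\<^sub>R x) \<bullet> z \<le> dual_norm N z"
      unfolding dual_norm_def
      by (rule cSUP_upper[OF _ bdd]) (use pos in \<open>simp add: is_norm_simps[OF assms]\<close>)
    then show ?thesis using pos by (simp add: field_simps)
  qed (simp add: is_norm_simps[OF assms])
qed

lemma abs_inner_le_dual_norm:
  fixes N :: "'a::euclidean_space \<Rightarrow> real"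
  assumes "is_norm N" "dual_norm N z \<le> L"
  shows "\<bar>z \<bullet> x\<bar> \<le> L * N x"
proof -
  have "x \<bullet> z \<le> N x * L" "(- x) \<bullet> z \<le> N (- x) * L"
    using inner_le_dual_norm[OF assms(1), of _ z] assms(2) is_norm_nonneg[OF assms(1)]
    by (meson mult_left_mono order_trans)+
  then show ?thesis by (simp add: is_norm_simps[OF assms(1)] inner_commute mult.commute abs_le_iff)
qed

lemma dual_norm_nonneg:
  fixes N :: "'a::euclidean_space \<Rightarrow> real"
  assumes "is_norm N"
  shows "0 \<le> dual_norm N z"
proof -
  obtain b :: 'a where "b \<in> Basis" using nonempty_Basis by blast
  then have "N b > 0" using assms is_norm_nonneg[OF assms, of b]
    unfolding is_norm_def by (metis less_le nonzero_Basis)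
  moreover have "0 \<le> N b * dual_norm N z"
    using abs_inner_le_dual_norm[OF assms order_refl, of z b] by (simp add: mult.commute)
  ultimately show ?thesis by (simp add: zero_le_mult_iff)
qed

lemma norm_mult_le_of_induced_norm:
  fixes N :: "real^'d \<Rightarrow> real"
  assumes "is_norm N" "induced_norm N A \<le> 1"
  shows "N (A *v x) \<le> N x"
proof -
  obtain B where B: "B > 0" "\<And>x. norm x \<le> B * N x" using euclidean_le_is_norm[OF assms(1)] by blast
  obtain C where C: "\<And>x. N x \<le> C * norm x" using is_norm_le_euclidean[OF assms(1)] by blast
  obtain D where D: "\<And>x. norm (A *v x) \<le> norm x * D"
    using bounded_linear.bounded[OF matrix_vector_mul_bounded_linear[of A]] by blast
  have bdd: "bdd_above ((\<lambda>x. N (A *v x)) ` {x. N x \<le> 1})"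
  proof (rule bdd_aboveI2)
    fix x assume "x \<in> {x. N x \<le> 1}"
    then have "B * N x \<le> B * 1" using B(1) by (intro mult_left_mono) auto
    then have 1: "norm x \<le> B" using B(2)[of x] by linarith
    have "N (A *v x) \<le> \<bar>C\<bar> * norm (A *v x)"
      using C[of "A *v x"] by (smt (verit) mult_right_mono norm_ge_zero)
    also have "\<dots> \<le> \<bar>C\<bar> * (norm x * \<bar>D\<bar>)"
      using D[of x] by (intro mult_left_mono) (smt (verit) mult_left_mono norm_ge_zero, simp)
    also have "\<dots> \<le> \<bar>C\<bar> * (B * \<bar>D\<bar>)"
      using 1 by (intro mult_left_mono mult_right_mono) auto
    finally show "N (A *v x) \<le> \<bar>C\<bar> * (B * \<bar>D\<bar>)" .
  qed
  show ?thesis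
  proof (cases "x = 0")
    case False
    then have pos: "N x > 0" using assms(1) is_norm_nonneg[OF assms(1), of x]
      unfolding is_norm_def by (metis less_le)
    have "N (A *v ((1 / N x) *\<^sub>R x)) \<le> induced_norm N A"
      unfolding induced_norm_def
      by (rule cSUP_upper[OF _ bdd]) (use pos in \<open>simp add: is_norm_simps[OF assms(1)]\<close>)
    then have "N (A *v x) \<le> N x * induced_norm N A" using pos
      by (simp add: matrix_vector_mult_scaleR is_norm_simps[OF assms(1)] field_simps)
    also have "\<dots> \<le> N x * 1" using pos assms(2) by (intro mult_left_mono) auto
    finally show ?thesis by simp
  qed (simp add: is_norm_simps[OF assms(1)])
qed

section \<open>First-order conditions on a convex domain\<close>

text \<open>
  Only segments that stay in the set are available, so the derivative within the set is used through
  one-sided difference quotients towards another point of the set. Convexity bounds these quotients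
  from above, minimality from below.
\<close>

lemma gradient_on_secant_tendsto:
  assumes "convex X" "x \<in> X" "y \<in> X" "gradient_on X f g"
  shows "((\<lambda>s. (f (x + s *\<^sub>R (y - x)) - f x) / s) \<longlongrightarrow> g x \<bullet> (y - x)) (at_right (0::real))"
proof -
  let ?p = "\<lambda>s::real. x + s *\<^sub>R (y - x)"
  have sub: "?p ` {0..1} \<subseteq> X"
  proof safe
    fix s :: real assume "s \<in> {0..1}"
    then show "?p s \<in> X"
      using convexD_alt[OF assms(1-3), of s] by (simp add: algebra_simps)
  qed
  have 1: "(?p has_vector_derivative (y - x)) (at 0 within {0..1})"
    by (auto intro!: derivative_eq_intros)
  have "(f has_derivative (\<lambda>h. g x \<bullet> h)) (at (?p 0) within ?p ` {0..1})"
    using assms(2,4) sub unfolding gradient_on_def by (auto intro: has_derivative_subset)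
  from vector_derivative_diff_chain_within[OF 1 this]
  have "((\<lambda>s. f (?p s)) has_real_derivative g x \<bullet> (y - x)) (at 0 within {0..1})"
    by (simp add: has_real_derivative_iff_has_vector_derivative o_def)
  moreover have "at 0 within {0..1} = at_right (0::real)"
    using at_within_Icc_at_right[of 0 "1::real"] by simp
  ultimately show ?thesis
    unfolding has_field_derivative_iff by simp
qed

lemma convex_on_gradient_ineq:
  assumes "convex_on X f" "x \<in> X" "y \<in> X" "gradient_on X f g"
  shows "g x \<bullet> (y - x) \<le> f y - f x"
proof (rule tendsto_upperbound)
  show "((\<lambda>s. (f (x + s *\<^sub>R (y - x)) - f x) / s) \<longlongrightarrow> g x \<bullet> (y - x)) (at_right (0::real))"
    using assms by (intro gradient_on_secant_tendsto) (auto simp: convex_on_def)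
  show "\<forall>\<^sub>F s in at_right (0::real). (f (x + s *\<^sub>R (y - x)) - f x) / s \<le> f y - f x"
    unfolding eventually_at_right_field
  proof (intro exI[of _ 1] conjI allI impI)
    fix s :: real assume s: "0 < s" "s < 1"
    have "f (x + s *\<^sub>R (y - x)) \<le> (1 - s) * f x + s * f y"
      using convex_onD[OF assms(1), of s x y] s assms by (simp add: algebra_simps)
    then show "(f (x + s *\<^sub>R (y - x)) - f x) / s \<le> f y - f x"
      using s by (simp add: field_simps)
  qed simp
qed simp

lemma arg_min_gradient_ineq:
  assumes "convex X" "gradient_on X f g" "is_arg_min f (\<lambda>z. z \<in> X) x" "y \<in> X"
  shows "0 \<le> g x \<bullet> (y - x)"
proof (rule tendsto_lowerbound)
  have x: "x \<in> X" "\<And>z. z \<in> X \<Longrightarrow> f x \<le> f z" using assms(3) unfolding is_arg_min_def by force+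
  show "((\<lambda>s. (f (x + s *\<^sub>R (y - x)) - f x) / s) \<longlongrightarrow> g x \<bullet> (y - x)) (at_right (0::real))"
    using assms x by (intro gradient_on_secant_tendsto) auto
  show "\<forall>\<^sub>F s in at_right (0::real). 0 \<le> (f (x + s *\<^sub>R (y - x)) - f x) / s"
    unfolding eventually_at_right_field
  proof (intro exI[of _ 1] conjI allI impI)
    fix s :: real assume s: "0 < s" "s < 1"
    have "x + s *\<^sub>R (y - x) \<in> X"
      using convexD_alt[OF assms(1) x(1) assms(4), of s] s by (simp add: algebra_simps)
    from x(2)[OF this] s show "0 \<le> (f (x + s *\<^sub>R (y - x)) - f x) / s" by simp
  qed simp
qed simp

section \<open>Spectral contraction of a connected doubly stochastic matrix\<close>

text \<open>
  On an invariant subspace, a unit vector maximising the length of its image under a self-adjoint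
  map is an eigenvector of the square of the map, with eigenvalue \<open>\<mu>\<^sup>2\<close>; factoring
  \<open>T\<^sup>2 - \<mu>\<^sup>2 = (T - \<mu>)(T + \<mu>)\<close> gives an eigenvector of the map itself.
\<close>

lemma selfadjoint_extremal_eigenvector:
  fixes T :: "'a::euclidean_space \<Rightarrow> 'a"
  assumes lin: "linear T" and adj: "\<And>u w. T u \<bullet> w = u \<bullet> T w"
    and S: "subspace S" "\<And>u. u \<in> S \<Longrightarrow> T u \<in> S" "S \<noteq> {0}"
  obtains v \<kappa> where "v \<in> S" "v \<noteq> 0" "T v = \<kappa> *\<^sub>R v" "\<And>u. u \<in> S \<Longrightarrow> norm (T u) \<le> \<bar>\<kappa>\<bar> * norm u"
proof -
  obtain u0 where u0: "u0 \<in> S" "u0 \<noteq> 0" using S(1,3) subspace_0 by blast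
  have "(1 / norm u0) *\<^sub>R u0 \<in> S \<inter> sphere 0 1" using u0 S(1) by (simp add: subspace_scale)
  then have ne: "S \<inter> sphere 0 1 \<noteq> {}" by blast
  have "compact (S \<inter> sphere 0 1)" using closed_subspace[OF S(1)] by (simp add: closed_Int_compact)
  moreover have "continuous_on (S \<inter> sphere 0 1) (\<lambda>u. norm (T u))"
    by (intro continuous_on_norm linear_continuous_on linear_conv_bounded_linear[THEN iffD1] lin)
  ultimately obtain v where v: "v \<in> S" "norm v = 1"
      and max: "\<And>u. u \<in> S \<Longrightarrow> norm u = 1 \<Longrightarrow> norm (T u) \<le> norm (T v)"
    using continuous_attains_sup[OF _ ne, of "\<lambda>u. norm (T u)"] by auto
  define \<mu> where "\<mu> = norm (T v)"
  have bound: "norm (T u) \<le> \<mu> * norm u" if "u \<in> S" for u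
  proof (cases "u = 0")
    case False
    have "norm (T ((1 / norm u) *\<^sub>R u)) \<le> \<mu>"
      unfolding \<mu>_def using False that S(1) by (intro max) (auto simp: subspace_scale)
    then show ?thesis using False by (simp add: linear_scale[OF lin] field_simps)
  qed (simp add: linear_0[OF lin])
  define w where "w = (\<mu>\<^sup>2) *\<^sub>R v - T (T v)"
  have wS: "w \<in> S" unfolding w_def using S v by (intro subspace_diff subspace_scale) auto
  have sq: "0 \<le> \<mu>\<^sup>2 * (u \<bullet> u) - T u \<bullet> T u" if "u \<in> S" for u
  proof -
    have "(norm (T u))\<^sup>2 \<le> (\<mu> * norm u)\<^sup>2" using bound[OF that] by (intro power_mono) auto
    then show ?thesis by (simp add: power_mult_distrib power2_norm_eq_inner)
  qed
  \<comment> \<open>The form above is nonnegative on \<open>S\<close> and vanishes at \<open>v\<close>, so its linear part at \<open>v\<close> vanishes.\<close>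
  have quad: "0 \<le> 2 * s * (w \<bullet> w) + s\<^sup>2 * (\<mu>\<^sup>2 * (w \<bullet> w) - T w \<bullet> T w)" for s
  proof -
    have "v + s *\<^sub>R w \<in> S" using S(1) v wS by (intro subspace_add subspace_scale) auto
    from sq[OF this] have "0 \<le> \<mu>\<^sup>2 * ((v + s *\<^sub>R w) \<bullet> (v + s *\<^sub>R w))
        - (T v + s *\<^sub>R T w) \<bullet> (T v + s *\<^sub>R T w)"
      by (simp add: linear_add[OF lin] linear_scale[OF lin])
    also have "\<dots> = (\<mu>\<^sup>2 * (v \<bullet> v) - T v \<bullet> T v) + 2 * s * (\<mu>\<^sup>2 * (v \<bullet> w) - T v \<bullet> T w)
        + s\<^sup>2 * (\<mu>\<^sup>2 * (w \<bullet> w) - T w \<bullet> T w)"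
      by (simp add: inner_add_left inner_add_right inner_commute algebra_simps power2_eq_square)
    also have "\<mu>\<^sup>2 * (v \<bullet> v) - T v \<bullet> T v = 0"
      using v(2) unfolding \<mu>_def by (simp add: power2_norm_eq_inner[symmetric])
    also have "\<mu>\<^sup>2 * (v \<bullet> w) - T v \<bullet> T w = w \<bullet> w"
      using adj[of "T v" w] by (simp add: w_def inner_diff_left)
    finally show ?thesis by simp
  qed
  have w0: "w = 0"
  proof (rule ccontr)
    assume "w \<noteq> 0"
    then have a: "w \<bullet> w > 0" by simp
    define b where "b = \<mu>\<^sup>2 * (w \<bullet> w) - T w \<bullet> T w"
    have b: "b \<ge> 0" unfolding b_def by (rule sq[OF wS])
    \<comment> \<open>A negative step so short that the quadratic term cannot make up for the linear one.\<close>
    define s where "s = - (w \<bullet> w) / (b + 1)"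
    have s: "s < 0" using a b by (simp add: s_def divide_neg_pos)
    have "0 \<le> s * (2 * (w \<bullet> w) + s * b)" using quad[of s] unfolding b_def[symmetric]
      by (simp add: algebra_simps power2_eq_square)
    then have "2 * (w \<bullet> w) + s * b \<le> 0" using s by (simp add: zero_le_mult_iff)
    moreover have "s * b \<ge> - (w \<bullet> w)" using a b by (simp add: s_def field_simps)
    ultimately show False using a by simp
  qed
  then have TT: "T (T v) = (\<mu>\<^sup>2) *\<^sub>R v" by (simp add: w_def)
  have \<mu>: "\<mu> \<ge> 0" by (simp add: \<mu>_def)
  show thesis
  proof (cases "T v = (- \<mu>) *\<^sub>R v")
    case True
    moreover have "v \<noteq> 0" using v(2) by auto
    ultimately show thesis using that[of v "- \<mu>"] v bound \<mu> by simp
  next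
    case False
    let ?u = "T v + \<mu> *\<^sub>R v"
    have "?u \<noteq> 0" using False by (simp add: add_eq_0_iff2)
    moreover have "?u \<in> S" using S v by (intro subspace_add subspace_scale) auto
    moreover have "T ?u = \<mu> *\<^sub>R ?u"
      by (simp add: linear_add[OF lin] linear_scale[OF lin] TT algebra_simps power2_eq_square)
    ultimately show thesis using that[of ?u \<mu>] bound \<mu> by auto
  qed
qed

lemma poly_charpoly: "poly (charpoly W) \<kappa> = det (mat \<kappa> - W)"
  unfolding charpoly_def det_def
  by (auto simp: poly_sum poly_prod mat_def intro!: sum.cong prod.cong)

lemma mat_scaleR: "mat c *v v = c *\<^sub>R (v :: real^'n)"
  by (simp add: vec_eq_iff matrix_vector_mult_def mat_def if_distrib[of "\<lambda>a. a * _"] cong: if_cong)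

lemma charpoly_root_iff_eigenvalue:
  "poly (charpoly W) \<kappa> = 0 \<longleftrightarrow> (\<exists>v. v \<noteq> 0 \<and> W *v v = \<kappa> *\<^sub>R v)"
proof -
  have "poly (charpoly W) \<kappa> = 0 \<longleftrightarrow> \<not> invertible (mat \<kappa> - W)"
    by (simp add: poly_charpoly invertible_det_nz)
  also have "\<dots> \<longleftrightarrow> \<not> (\<forall>v. (mat \<kappa> - W) *v v = 0 \<longrightarrow> v = 0)"
    by (simp add: invertible_left_inverse matrix_left_invertible_ker)
  also have "(\<lambda>v. (mat \<kappa> - W) *v v) = (\<lambda>v. \<kappa> *\<^sub>R v - W *v v)"
    by (simp add: matrix_vector_mult_diff_rdistrib mat_scaleR)
  finally show ?thesis by (auto simp: fun_eq_iff)
qed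

lemma sigma2_nonneg: "0 \<le> sigma2 W"
proof (cases "length (eigenvalue_magnitudes W) \<ge> 2")
  case True
  then have "eigenvalue_magnitudes W ! 1 \<in> set (eigenvalue_magnitudes W)" by (intro nth_mem) simp
  then show ?thesis using True by (auto simp: sigma2_def eigenvalue_magnitudes_def Let_def)
qed (simp add: sigma2_def)

text \<open>
  The second entry of a decreasing list is at least \<open>c\<close> as soon as two entries are; here the two
  entries come from two different roots.
\<close>

lemma sigma2_ge:
  assumes "charpoly W \<noteq> 0" "poly (charpoly W) a = 0" "poly (charpoly W) b = 0" "a \<noteq> b"
    and "c \<le> \<bar>a\<bar>" "c \<le> \<bar>b\<bar>"
  shows "c \<le> sigma2 W"
proof -
  define P where "P = image_mset abs (proots (charpoly W))"
  define ls where "ls = eigenvalue_magnitudes W"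
  have mset_ls: "mset ls = P" by (simp add: ls_def eigenvalue_magnitudes_def P_def)
  have sorted: "sorted (rev ls)" by (simp add: ls_def eigenvalue_magnitudes_def)
  have "{#a, b#} \<subseteq># proots (charpoly W)"
  proof (rule mset_subset_eqI)
    fix x
    show "count {#a, b#} x \<le> count (proots (charpoly W)) x"
      using assms(1-4) order_root[of "charpoly W" a] order_root[of "charpoly W" b]
      by (auto simp: Suc_le_eq)
  qed
  then have "{#\<bar>a\<bar>, \<bar>b\<bar>#} \<subseteq># P"
    unfolding P_def by (metis image_mset_add_mset image_mset_empty image_mset_subseteq_mono)
  then have "filter_mset (\<lambda>x. c \<le> x) {#\<bar>a\<bar>, \<bar>b\<bar>#} \<subseteq># filter_mset (\<lambda>x. c \<le> x) P"
    by (rule multiset_filter_mono)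
  from size_mset_mono[OF this] have two: "2 \<le> length (filter (\<lambda>x. c \<le> x) ls)"
    using assms(5,6) by (simp add: mset_ls[symmetric] flip: mset_filter size_mset)
  then have len: "2 \<le> length ls" by (rule order_trans) simp
  obtain x y zs where ls: "ls = x # y # zs"
    using len by (cases ls; cases "tl ls") auto
  have "c \<le> y"
  proof (rule ccontr)
    assume "\<not> c \<le> y"
    moreover have "\<forall>z\<in>set zs. z \<le> y" using sorted by (auto simp: ls sorted_append)
    ultimately have "filter (\<lambda>x. c \<le> x) (y # zs) = []" by (auto simp: filter_empty_conv)
    then show False using two by (auto simp: ls split: if_splits)
  qed
  then show ?thesis using len unfolding sigma2_def ls_def[symmetric] by (simp add: ls)
qed

lemma finite_attains_max:
  fixes h :: "'i::finite \<Rightarrow> 'b::linorder"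
  obtains i where "\<And>j. h j \<le> h i"
proof -
  have "Max (range h) \<in> range h" by (rule Max_in) auto
  then obtain i where "Max (range h) = h i" by blast
  then have "h j \<le> h i" for j using Max_ge[of "range h" "h j"] by simp
  then show thesis by (rule that)
qed

text \<open>Compare at an entry of the eigenvector that is largest in absolute value.\<close>

lemma stochastic_eigenvalue_le_1:
  fixes W :: "real^'n^'n"
  assumes "\<And>i j. W $ i $ j \<ge> 0" "\<And>i. (\<Sum>j\<in>UNIV. W $ i $ j) = 1"
    and "W *v v = \<kappa> *\<^sub>R v" "v \<noteq> 0"
  shows "\<bar>\<kappa>\<bar> \<le> 1"
proof -
  obtain i where i: "\<And>j. \<bar>v $ j\<bar> \<le> \<bar>v $ i\<bar>"
    using finite_attains_max[of "\<lambda>j. \<bar>v $ j\<bar>"] by blast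
  obtain k where "v $ k \<noteq> 0" using assms(4) by (auto simp: vec_eq_iff)
  then have pos: "\<bar>v $ i\<bar> > 0" using i[of k] by simp
  have "\<bar>\<kappa>\<bar> * \<bar>v $ i\<bar> = \<bar>\<Sum>j\<in>UNIV. W $ i $ j * v $ j\<bar>"
    using assms(3) by (simp add: vec_eq_iff matrix_vector_mult_def abs_mult)
  also have "\<dots> \<le> (\<Sum>j\<in>UNIV. W $ i $ j * \<bar>v $ j\<bar>)"
    using assms(1) by (intro order_trans[OF sum_abs]) (simp add: abs_mult)
  also have "\<dots> \<le> (\<Sum>j\<in>UNIV. W $ i $ j * \<bar>v $ i\<bar>)"
    using assms(1) i by (intro sum_mono mult_left_mono) auto
  also have "\<dots> = 1 * \<bar>v $ i\<bar>" using assms(2) by (simp flip: sum_distrib_right)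
  finally show ?thesis using pos by simp
qed

text \<open>
  Maximum principle: a maximal entry of a fixed vector is an average of the neighbouring entries,
  so these are maximal too, and connectivity spreads this to all entries.
\<close>

lemma connected_stochastic_fixed_const:
  fixes W :: "real^'n^'n"
  assumes nn: "\<And>i j. W $ i $ j \<ge> 0" and row: "\<And>i. (\<Sum>j\<in>UNIV. W $ i $ j) = 1"
    and edge: "\<And>i j. i \<noteq> j \<Longrightarrow> E i j \<Longrightarrow> W $ i $ j > 0" and conn: "\<And>i j. E\<^sup>*\<^sup>* i j"
    and fixed: "W *v v = v"
  obtains c where "\<And>i. v $ i = c"
proof -
  obtain i where i: "\<And>j. v $ j \<le> v $ i"
    using finite_attains_max[of "\<lambda>j. v $ j"] by blast
  have "v $ j = v $ i" for j
    using conn[of i j]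
  proof (induction rule: rtranclp_induct)
    case (step k l)
    have "(\<Sum>j\<in>UNIV. W $ k $ j * (v $ i - v $ j)) = v $ i - (W *v v) $ k"
      by (simp add: right_diff_distrib sum_subtractf matrix_vector_mult_def row flip: sum_distrib_right)
    also have "\<dots> = 0" using step.IH by (simp add: fixed)
    finally have "\<forall>j\<in>UNIV. W $ k $ j * (v $ i - v $ j) = 0"
      using nn i by (subst (asm) sum_nonneg_eq_0_iff) auto
    then have "W $ k $ l * (v $ i - v $ l) = 0" by blast
    then show ?case using step edge[of k l] by (cases "k = l") auto
  qed simp
  then show thesis by (rule that)
qed

text \<open>
  The vectors with entry sum \<open>0\<close> form an invariant subspace. The extremal eigenvalue on it differs
  from \<open>1\<close> by the maximum principle, so together with the eigenvalue \<open>1\<close> of the constant vector it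
  accounts for two roots of the characteristic polynomial, and the second largest magnitude is at
  least as large.
\<close>

lemma doubly_stochastic_contraction:
  fixes W :: "real^'n^'n"
  assumes nn: "\<And>i j. W $ i $ j \<ge> 0" and row: "\<And>i. (\<Sum>j\<in>UNIV. W $ i $ j) = 1"
    and sym: "transpose W = W"
    and edge: "\<And>i j. i \<noteq> j \<Longrightarrow> E i j \<Longrightarrow> W $ i $ j > 0" and conn: "\<And>i j. E\<^sup>*\<^sup>* i j"
    and u: "(\<Sum>i\<in>UNIV. u $ i) = 0"
  shows "(\<Sum>i\<in>UNIV. (W *v u) $ i) = 0" "norm (W *v u) \<le> sigma2 W * norm u"
proof -
  define S where "S = {u :: real^'n. (\<Sum>i\<in>UNIV. u $ i) = 0}"
  define one :: "real^'n" where "one = vec 1"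
  have W_one: "W *v one = one" by (simp add: one_def vec_eq_iff matrix_vector_mult_def row)
  have adj: "(W *v a) \<bullet> b = a \<bullet> (W *v b)" for a b
    using dot_lmul_matrix[of a W b] sym by (simp add: vector_transpose_matrix[symmetric])
  have S_eq: "S = {u. one \<bullet> u = 0}" by (simp add: S_def one_def inner_vec_def)
  have sub: "subspace S" unfolding S_eq by (rule subspace_hyperplane)
  have inv: "W *v a \<in> S" if "a \<in> S" for a
    using that adj[of one a] by (simp add: S_eq W_one)
  show "(\<Sum>i\<in>UNIV. (W *v u) $ i) = 0" using inv[of u] u by (simp add: S_def)
  show "norm (W *v u) \<le> sigma2 W * norm u"
  proof (cases "S = {0}")
    case True
    then have "u = 0" using u by (auto simp: S_def)
    then show ?thesis by simp
  next
    case False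
    obtain v \<kappa> where v: "v \<in> S" "v \<noteq> 0" "W *v v = \<kappa> *\<^sub>R v"
        and bound: "\<And>u. u \<in> S \<Longrightarrow> norm (W *v u) \<le> \<bar>\<kappa>\<bar> * norm u"
      using selfadjoint_extremal_eigenvector[OF matrix_vector_mul_linear adj sub inv False] by blast
    have "\<kappa> \<noteq> 1"
    proof
      assume "\<kappa> = 1"
      then obtain c where c: "\<And>i. v $ i = c"
        using connected_stochastic_fixed_const[OF nn row edge conn, of v] v(3) by auto
      then have "c = 0" using v(1) by (simp add: S_def)
      then show False using c v(2) by (simp add: vec_eq_iff)
    qed
    moreover have le1: "\<bar>\<kappa>\<bar> \<le> 1" by (rule stochastic_eigenvalue_le_1[OF nn row v(3,2)])
    moreover have "one \<noteq> 0" by (simp add: one_def vec_eq_iff)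
    then have "poly (charpoly W) 1 = 0" unfolding charpoly_root_iff_eigenvalue
      using W_one by auto
    moreover have "poly (charpoly W) \<kappa> = 0" unfolding charpoly_root_iff_eigenvalue using v by blast
    \<comment> \<open>A point that is not an eigenvalue shows that the polynomial is not zero, so that it has a
      multiset of roots.\<close>
    moreover have "poly (charpoly W) 2 \<noteq> 0" unfolding charpoly_root_iff_eigenvalue
      using stochastic_eigenvalue_le_1[OF nn row, of _ 2] by auto
    then have "charpoly W \<noteq> 0" by auto
    ultimately have "\<bar>\<kappa>\<bar> \<le> sigma2 W" by (intro sigma2_ge[of W 1 \<kappa>]) auto
    then show ?thesis using bound[of u] u mult_right_mono[of "\<bar>\<kappa>\<bar>" "sigma2 W" "norm u"]
      by (simp add: S_def)
  qed
qed

section \<open>One mirror descent step\<close>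

lemma bregman_ge_half_square:
  assumes "strongly_convex_wrt N X R gR" "x \<in> X" "y \<in> X"
  shows "1/2 * (N (x - y))\<^sup>2 \<le> bregman R gR x y"
  using assms unfolding strongly_convex_wrt_def bregman_def
  by (force simp: inner_commute)

lemma bregman_self [simp]: "bregman R gR x x = 0"
  by (simp add: bregman_def)

text \<open>
  The divergence vanishes on the diagonal, so its Lipschitz property bounds it by a multiple of the
  diameter of the domain.
\<close>

lemma bregman_bdd_above:
  assumes "is_norm (N :: real^'d \<Rightarrow> real)" "compact X"
    and lip: "\<And>z y w. z \<in> X \<Longrightarrow> y \<in> X \<Longrightarrow> w \<in> X \<Longrightarrow>
        \<bar>bregman R gR z w - bregman R gR y w\<bar> \<le> K * N (z - y)"
  shows "bdd_above ((\<lambda>(z, y). bregman R gR z y) ` (X \<times> X))"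
proof -
  have "bdd_above (N ` X)"
    using assms(2) is_norm_continuous[OF assms(1)]
    by (intro bounded_imp_bdd_above compact_imp_bounded compact_continuous_image)
  then obtain B where B: "\<And>z. z \<in> X \<Longrightarrow> N z \<le> B" by (auto simp: bdd_above_def)
  show ?thesis
  proof (rule bdd_aboveI2)
    fix p assume "p \<in> X \<times> X"
    then obtain z y where p: "p = (z, y)" "z \<in> X" "y \<in> X" by auto
    have "bregman R gR z y \<le> K * N (z - y)" using lip[of z y y] p by simp
    also have "\<dots> \<le> \<bar>K\<bar> * N (z - y)"
      using is_norm_nonneg[OF assms(1)] by (intro mult_right_mono) auto
    also have "N (z - y) \<le> B + B"
      using is_norm_triangle[OF assms(1), of z "- y"] is_norm_simps(2)[OF assms(1), of y] B[OF p(2)] B[OF p(3)]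
      by simp
    finally show "(case p of (z, y) \<Rightarrow> bregman R gR z y) \<le> \<bar>K\<bar> * (B + B)"
      using p by (simp add: mult_left_mono)
  qed
qed

text \<open>
  The gradient of the objective at its minimiser makes a nonnegative inner product with every
  feasible direction, and the three Bregman divergences express exactly this inner product.
\<close>

lemma mirror_step_three_point:
  assumes "convex X" "gradient_on X R gR" "z \<in> X"
    and min: "is_arg_min (\<lambda>z. e * (z \<bullet> g) + bregman R gR z y) (\<lambda>z. z \<in> X) p"
  shows "e * (g \<bullet> (p - z)) \<le> bregman R gR z y - bregman R gR z p - bregman R gR p y"
proof -
  have "gradient_on X (\<lambda>z. e * (z \<bullet> g) + bregman R gR z y) (\<lambda>z. e *\<^sub>R g + gR z - gR y)"
    using assms(2) unfolding gradient_on_def bregman_def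
    by (auto intro!: derivative_eq_intros simp: inner_add_left inner_diff_left inner_commute[of _ "gR _"] inner_commute[of _ g] fun_eq_iff)
  from arg_min_gradient_ineq[OF assms(1) this min assms(3)]
  have "0 \<le> (e *\<^sub>R g + gR p - gR y) \<bullet> (z - p)" .
  then show ?thesis
    by (simp add: bregman_def inner_add_left inner_diff_left inner_diff_right inner_commute algebra_simps)
qed

text \<open>
  Comparing with the centre \<open>y\<close> itself, the two divergences on the right of the three-point inequality
  together dominate the squared displacement, while the left side is linear in the displacement.
\<close>

lemma mirror_step_displacement:
  fixes X :: "'a::euclidean_space set"
  assumes "is_norm N" "convex X" "gradient_on X R gR" "strongly_convex_wrt N X R gR" "y \<in> X"
    and min: "is_arg_min (\<lambda>z. e * (z \<bullet> g) + bregman R gR z y) (\<lambda>z. z \<in> X) p"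
    and g: "dual_norm N g \<le> L" and e: "e > 0"
  shows "N (p - y) \<le> e * L"
proof -
  have p: "p \<in> X" using min by (simp add: is_arg_min_def)
  have "e * (g \<bullet> (p - y)) \<le> - bregman R gR y p - bregman R gR p y"
    using mirror_step_three_point[OF assms(2,3,5) min] by simp
  then have "(N (p - y))\<^sup>2 \<le> - (e * (g \<bullet> (p - y)))"
    using bregman_ge_half_square[OF assms(4,5) p] bregman_ge_half_square[OF assms(4) p assms(5)]
    unfolding is_norm_simps(4)[OF assms(1), of y p] by linarith
  also have "\<dots> = e * (- (g \<bullet> (p - y)))" by simp
  also have "\<dots> \<le> e * (L * N (p - y))"
    using abs_inner_le_dual_norm[OF assms(1) g, of "p - y"] e
    by (intro mult_left_mono) auto
  finally have "N (p - y) * N (p - y) \<le> (e * L) * N (p - y)" by (simp add: power2_eq_square)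
  moreover have "0 \<le> e * L" using dual_norm_nonneg[OF assms(1), of g] g e by simp
  ultimately show ?thesis using is_norm_nonneg[OF assms(1), of "p - y"]
    by (cases "N (p - y) = 0") auto
qed

text \<open>
  The gradient is received at a point \<open>w\<close> other than the centre \<open>y\<close> of the step, which costs the
  distance of the two. The loss of moving from \<open>y\<close> to \<open>p\<close> is absorbed by the strong convexity term,
  since \<open>L r - r\<^sup>2 / (2 e) \<le> e L\<^sup>2 / 2\<close> for all \<open>r\<close>.
\<close>

lemma mirror_step_linear_regret:
  fixes X :: "'a::euclidean_space set"
  assumes "is_norm N" "convex X" "gradient_on X R gR" "strongly_convex_wrt N X R gR" "y \<in> X" "z \<in> X"
    and min: "is_arg_min (\<lambda>z. e * (z \<bullet> g) + bregman R gR z y) (\<lambda>z. z \<in> X) p"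
    and g: "dual_norm N g \<le> L" and e: "e > 0"
  shows "g \<bullet> (w - z) \<le> L * N (w - y) + L\<^sup>2 * (e / 2) + (bregman R gR z y - bregman R gR z p) / e"
proof -
  have p: "p \<in> X" using min by (simp add: is_arg_min_def)
  define r where "r = N (p - y)"
  have "g \<bullet> (w - z) = g \<bullet> (w - y) + (- (g \<bullet> (p - y))) + g \<bullet> (p - z)"
    by (simp add: inner_diff_right)
  also have "\<dots> \<le> L * N (w - y) + L * r + (bregman R gR z y - bregman R gR z p - 1/2 * r\<^sup>2) / e"
  proof (intro add_mono)
    show "g \<bullet> (w - y) \<le> L * N (w - y)" "- (g \<bullet> (p - y)) \<le> L * r"
      unfolding r_def using abs_inner_le_dual_norm[OF assms(1) g] by (simp_all add: abs_le_iff)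
    have "e * (g \<bullet> (p - z)) \<le> bregman R gR z y - bregman R gR z p - 1/2 * r\<^sup>2"
      unfolding r_def using mirror_step_three_point[OF assms(2,3,6) min]
        bregman_ge_half_square[OF assms(4) p assms(5)] by simp
    then show "g \<bullet> (p - z) \<le> (bregman R gR z y - bregman R gR z p - 1/2 * r\<^sup>2) / e"
      using e by (simp add: pos_le_divide_eq mult.commute)
  qed
  also have "L * r \<le> L\<^sup>2 * (e / 2) + 1/2 * r\<^sup>2 / e"
  proof -
    have "0 \<le> (L * e - r)\<^sup>2 / (2 * e)" using e by simp
    also have "\<dots> = L\<^sup>2 * (e / 2) + 1/2 * r\<^sup>2 / e - L * r"
      using e by (simp add: power2_eq_square field_simps)
    finally show ?thesis by simp
  qed
  finally show ?thesis by (simp add: diff_divide_distrib)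
qed

text \<open>
  Summation by parts: the step sizes decrease, so each increase of \<open>1 / \<eta> t\<close> multiplies a potential
  bounded by \<open>C\<close>, and these increases telescope.
\<close>

lemma weighted_telescoping_le:
  fixes a \<eta> :: "nat \<Rightarrow> real"
  assumes "\<And>t. \<eta> t > 0" "decseq \<eta>" "\<And>t. t \<in> {1..T + 1} \<Longrightarrow> 0 \<le> a t \<and> a t \<le> C"
  shows "(\<Sum>t=1..T. (a t - a (t + 1)) / \<eta> t) \<le> C / \<eta> (T + 1)"
proof -
  have "(\<Sum>t=1..T. (a t - a (t + 1)) / \<eta> t) + a (T + 1) / \<eta> (T + 1) \<le> C / \<eta> (T + 1)"
    using assms(3)
  proof (induction T)
    case 0
    then show ?case using assms(1)[of 1] by (simp add: divide_right_mono)
  next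
    case (Suc T)
    have inv: "1 / \<eta> (T + 1) \<le> 1 / \<eta> (T + 2)"
      using decseqD[OF assms(2), of "T + 1" "T + 2"] assms(1) by (intro divide_left_mono) auto
    have "(\<Sum>t=1..Suc T. (a t - a (t + 1)) / \<eta> t) + a (Suc T + 1) / \<eta> (Suc T + 1)
        = ((\<Sum>t=1..T. (a t - a (t + 1)) / \<eta> t) + a (T + 1) / \<eta> (T + 1))
          + a (T + 2) * (1 / \<eta> (T + 2) - 1 / \<eta> (T + 1))"
      by (simp add: diff_divide_distrib right_diff_distrib)
    also have "\<dots> \<le> C / \<eta> (T + 1) + C * (1 / \<eta> (T + 2) - 1 / \<eta> (T + 1))"
      using Suc.IH Suc.prems inv by (intro add_mono mult_right_mono) auto
    also have "\<dots> = C / \<eta> (Suc T + 1)" by (simp add: right_diff_distrib)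
    finally show ?case .
  qed
  moreover have "0 \<le> a (T + 1) / \<eta> (T + 1)" using assms(1)[of "T + 1"] assms(3)[of "T + 1"] by simp
  ultimately show ?thesis by linarith
qed

section \<open>Regret of a single realisation\<close>

lemma sum_abs_le_sqrt_card_norm:
  fixes c :: "real^'n"
  shows "(\<Sum>i\<in>UNIV. \<bar>c $ i\<bar>) \<le> sqrt (real CARD('n)) * norm c"
proof -
  have "(\<Sum>i\<in>UNIV. \<bar>c $ i\<bar> * \<bar>1\<bar>) \<le> L2_set (\<lambda>i. c $ i) UNIV * L2_set (\<lambda>i::'n. 1) UNIV"
    by (rule L2_set_mult_ineq)
  then show ?thesis by (simp add: norm_vec_def L2_set_def mult.commute)
qed

text \<open>The data shared by all realisations; gradients, losses and targets vary with the sample point.\<close>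

locale distributed_mirror_descent =
  fixes X :: "(real^'d) set" and N :: "real^'d \<Rightarrow> real"
    and R :: "real^'d \<Rightarrow> real" and gR :: "real^'d \<Rightarrow> real^'d"
    and E :: "'n::finite \<Rightarrow> 'n \<Rightarrow> bool" and W :: "real^'n^'n" and A :: "real^'d^'d"
    and \<eta> :: "nat \<Rightarrow> real" and L K rad :: real
  assumes norm: "is_norm N"
    and domain: "convex X" "0 \<in> X" "\<And>z. z \<in> X \<Longrightarrow> A *v z \<in> X"
    and mirror_map: "gradient_on X R gR" "strongly_convex_wrt N X R gR"
    and bregman_le: "\<And>z y. z \<in> X \<Longrightarrow> y \<in> X \<Longrightarrow> bregman R gR z y \<le> rad\<^sup>2"
    and step_size: "\<And>t. \<eta> t > 0" "decseq \<eta>"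
    and connected: "\<And>i j. E\<^sup>*\<^sup>* i j"
    and weights: "\<And>i j. W $ i $ j \<ge> 0" "\<And>i j. i \<noteq> j \<Longrightarrow> E i j \<Longrightarrow> W $ i $ j > 0"
      "transpose W = W" "\<And>j. (\<Sum>i\<in>UNIV. W $ i $ j) = 1" "\<And>i. (\<Sum>j\<in>UNIV. W $ i $ j) = 1"
    and separate_convexity: "\<And>z (y :: 'n \<Rightarrow> real^'d) (\<alpha> :: 'n \<Rightarrow> real).
        z \<in> X \<Longrightarrow> (\<And>i. y i \<in> X) \<Longrightarrow> (\<And>i. \<alpha> i \<ge> 0) \<Longrightarrow> (\<Sum>i\<in>UNIV. \<alpha> i) = 1 \<Longrightarrow>
        bregman R gR z (\<Sum>i\<in>UNIV. \<alpha> i *\<^sub>R y i) \<le> (\<Sum>i\<in>UNIV. \<alpha> i * bregman R gR z (y i))"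
    and bregman_lipschitz: "\<And>z y w. z \<in> X \<Longrightarrow> y \<in> X \<Longrightarrow> w \<in> X \<Longrightarrow>
        \<bar>bregman R gR z w - bregman R gR y w\<bar> \<le> K * N (z - y)"
    and non_expansive:
      "\<And>z y. z \<in> X \<Longrightarrow> y \<in> X \<Longrightarrow> bregman R gR (A *v z) (A *v y) \<le> bregman R gR z y"
      "\<And>z. N (A *v z) \<le> N z"
begin

context
  fixes T :: nat and g xh x :: "'n \<Rightarrow> nat \<Rightarrow> real^'d"
  assumes run: "mirror_descent_run X R gR W A \<eta> T g xh x"
begin

lemma run_initial: "x i 1 = 0"
  using run by (simp add: mirror_descent_run_def)

lemma run_step:
  assumes "t \<in> {1..T}"
  shows "is_arg_min (\<lambda>z. \<eta> t * (z \<bullet> g i t) + bregman R gR z (mixed W x i t)) (\<lambda>z. z \<in> X) (xh i (t + 1))"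
    and "x i (t + 1) = A *v xh i (t + 1)" and "xh i (t + 1) \<in> X"
  using run assms by (auto simp: mirror_descent_run_def is_arg_min_def)

lemma estimate_in_domain:
  assumes "t \<in> {1..T + 1}"
  shows "x i t \<in> X"
proof (cases "t = 1")
  case False
  then have "t - 1 \<in> {1..T}" "t - 1 + 1 = t" using assms by auto
  then show ?thesis using run_step(2,3)[of "t - 1" i] domain(3) by metis
qed (use run_initial domain(2) in simp)

lemma mixed_in_domain:
  assumes "t \<in> {1..T + 1}"
  shows "mixed W x i t \<in> X"
  unfolding mixed_def
  using weights estimate_in_domain[OF assms] domain(1) by (intro convex_sum) auto

context
  assumes gradient_bound: "\<And>i t. t \<in> {1..T} \<Longrightarrow> dual_norm N (g i t) \<le> L"
begin

text \<open>
  With \<open>c\<close> arbitrary, one round replaces \<open>c\<close> by \<open>W c\<close>, whose entries again sum to \<open>0\<close> and whose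
  length has shrunk by the second eigenvalue, and adds the displacements of the mirror steps. This
  avoids unrolling the recursion into powers of \<open>W\<close> and \<open>A\<close>.
\<close>

lemma balanced_combination_bound:
  assumes "t \<le> T" "(\<Sum>i\<in>UNIV. c $ i) = 0"
  shows "N (\<Sum>i\<in>UNIV. c $ i *\<^sub>R x i (t + 1))
    \<le> L * sqrt (real CARD('n)) * norm c * (\<Sum>\<tau>=1..t. \<eta> \<tau> * sigma2 W ^ (t - \<tau>))"
  using assms
proof (induction t arbitrary: c)
  case 0
  have "x i (Suc 0) = 0" for i using run_initial[of i] by simp
  then show ?case by (simp add: is_norm_simps[OF norm])
next
  case (Suc t)
  let ?t = "Suc t" and ?n = "sqrt (real CARD('n))"
  let ?Q = "\<Sum>\<tau>=1..t. \<eta> \<tau> * sigma2 W ^ (t - \<tau>)"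
  have t: "?t \<in> {1..T}" using Suc.prems by simp
  have L: "L \<ge> 0" using gradient_bound[OF t] dual_norm_nonneg[OF norm] order_trans by blast
  note contraction = doubly_stochastic_contraction[OF weights(1,5,3,2) connected Suc.prems(2)]
  have disp: "N (xh i (?t + 1) - mixed W x i ?t) \<le> \<eta> ?t * L" for i
    using run_step(1)[OF t, of i] mixed_in_domain[of ?t i] t gradient_bound[OF t] step_size(1)
    by (intro mirror_step_displacement[OF norm domain(1) mirror_map]) auto
  let ?mix = "\<Sum>j\<in>UNIV. (W *v c) $ j *\<^sub>R x j ?t"
    and ?move = "\<Sum>i\<in>UNIV. c $ i *\<^sub>R (xh i (?t + 1) - mixed W x i ?t)"
  have image: "(\<Sum>i\<in>UNIV. c $ i *\<^sub>R x i (?t + 1)) = A *v (\<Sum>i\<in>UNIV. c $ i *\<^sub>R xh i (?t + 1))"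
    using run_step(2)[OF t] by (simp add: linear_sum[OF matrix_vector_mul_linear] matrix_vector_mult_scaleR)
  have mixing: "(\<Sum>i\<in>UNIV. c $ i *\<^sub>R mixed W x i ?t) = ?mix"
  proof -
    have sym: "W $ i $ j = W $ j $ i" for i j
      using arg_cong[OF weights(3), of "\<lambda>V. V $ i $ j"] by (simp add: transpose_def)
    have "(\<Sum>i\<in>UNIV. c $ i *\<^sub>R mixed W x i ?t) = (\<Sum>i\<in>UNIV. \<Sum>j\<in>UNIV. (c $ i * W $ i $ j) *\<^sub>R x j ?t)"
      by (simp add: mixed_def scaleR_sum_right)
    also have "\<dots> = (\<Sum>j\<in>UNIV. \<Sum>i\<in>UNIV. (c $ i * W $ i $ j) *\<^sub>R x j ?t)" by (rule sum.swap)
    also have "\<dots> = (\<Sum>j\<in>UNIV. (W *v c) $ j *\<^sub>R x j ?t)"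
      by (simp add: matrix_vector_mult_def scaleR_sum_left sym mult.commute)
    finally show ?thesis .
  qed
  have split: "(\<Sum>i\<in>UNIV. c $ i *\<^sub>R xh i (?t + 1)) = ?mix + ?move"
    unfolding mixing[symmetric] by (simp add: scaleR_diff_right sum_subtractf)
  have "N (\<Sum>i\<in>UNIV. c $ i *\<^sub>R x i (?t + 1)) \<le> N (?mix + ?move)"
    unfolding image split[symmetric] by (rule non_expansive(2))
  also have "\<dots> \<le> N ?mix + N ?move" by (rule is_norm_triangle[OF norm])
  also have "\<dots> \<le> L * ?n * norm c * (sigma2 W * ?Q) + L * ?n * norm c * \<eta> ?t"
  proof (rule add_mono)
    have Q: "?Q \<ge> 0" using step_size(1) sigma2_nonneg
      by (intro sum_nonneg mult_nonneg_nonneg zero_le_power) (auto intro: less_imp_le)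
    have "N ?mix \<le> L * ?n * norm (W *v c) * ?Q"
      using Suc.IH[of "W *v c"] Suc.prems(1) contraction(1) by simp
    also have "\<dots> \<le> L * ?n * (sigma2 W * norm c) * ?Q"
      using contraction(2) L Q by (intro mult_right_mono mult_left_mono) auto
    finally show "N ?mix \<le> L * ?n * norm c * (sigma2 W * ?Q)"
      by (simp only: mult_ac)
    have "N ?move
        \<le> (\<Sum>i\<in>UNIV. \<bar>c $ i\<bar> * N (xh i (?t + 1) - mixed W x i ?t))"
      by (rule order_trans[OF is_norm_sum_le[OF norm]]) (simp add: is_norm_simps[OF norm])
    also have "\<dots> \<le> (\<Sum>i\<in>UNIV. \<bar>c $ i\<bar> * (\<eta> ?t * L))"
      by (intro sum_mono mult_left_mono disp) simp
    also have "\<dots> \<le> (?n * norm c) * (\<eta> ?t * L)"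
      unfolding sum_distrib_right[symmetric]
      using sum_abs_le_sqrt_card_norm[of c] L step_size(1)[of ?t] by (intro mult_right_mono) auto
    finally show "N ?move \<le> L * ?n * norm c * \<eta> ?t"
      by (simp only: mult_ac)
  qed
  also have "\<dots> = L * ?n * norm c * (\<Sum>\<tau>=1..?t. \<eta> \<tau> * sigma2 W ^ (?t - \<tau>))"
  proof -
    have "sigma2 W * ?Q = (\<Sum>\<tau>=1..t. \<eta> \<tau> * sigma2 W ^ (?t - \<tau>))"
      by (simp add: sum_distrib_left Suc_diff_le mult_ac)
    then have "(\<Sum>\<tau>=1..?t. \<eta> \<tau> * sigma2 W ^ (?t - \<tau>)) = sigma2 W * ?Q + \<eta> ?t" by simp
    then show ?thesis by (simp only: distrib_left)
  qed
  finally show ?case .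
qed

text \<open>
  An upper bound for the distance of an agent from the average, scaled so that \<open>4 L\<close> times its sum
  over the rounds is the network error. The summation range is that of the network error; the mirror
  steps before round \<open>t\<close> are those with \<open>1 \<le> \<tau> < t\<close>.
\<close>

definition disagreement :: "nat \<Rightarrow> real" where
  "disagreement t = L * sqrt (real CARD('n)) * (\<Sum>\<tau>=0..t-1. \<eta> \<tau> * sigma2 W ^ (t - \<tau> - 1))"

definition average :: "nat \<Rightarrow> real^'d" where
  "average t = (\<Sum>j\<in>UNIV. (1 / real CARD('n)) *\<^sub>R x j t)"

text \<open>
  The deviation of agent \<open>i\<close> from the average is the balanced combination whose coefficient vector is
  the projection of the \<open>i\<close>-th unit vector to the vectors with entry sum \<open>0\<close>.
\<close>

lemma distance_to_average:
  assumes t: "t \<in> {1..T}"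
  shows "N (x i t - average t) \<le> disagreement t"
proof -
  let ?n = "real CARD('n)"
  define c :: "real^'n" where "c = axis i 1 - vec (1 / ?n)"
  have "(\<Sum>j\<in>UNIV. c $ j) = 0"
    by (simp add: c_def axis_def sum_subtractf)
  moreover have "t - 1 \<le> T" "t - 1 + 1 = t" using t by auto
  moreover have "(\<Sum>j\<in>UNIV. c $ j *\<^sub>R x j t) = x i t - average t"
    by (simp add: c_def axis_def average_def scaleR_diff_left sum_subtractf
        if_distrib[of "\<lambda>a. a *\<^sub>R _"] cong: if_cong)
  ultimately have "N (x i t - average t)
      \<le> L * sqrt ?n * norm c * (\<Sum>\<tau>=1..t-1. \<eta> \<tau> * sigma2 W ^ (t - 1 - \<tau>))"
    using balanced_combination_bound[of "t - 1" c] by metis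
  also have "\<dots> \<le> disagreement t"
    unfolding disagreement_def
  proof (rule mult_mono)
    have L: "L \<ge> 0" using gradient_bound[OF t] dual_norm_nonneg[OF norm] order_trans by blast
    have "c \<bullet> c = 1 - 1 / ?n"
      by (simp add: c_def inner_diff_left inner_diff_right inner_axis inner_axis' )
        (simp add: inner_vec_def power2_eq_square)
    then have "norm c \<le> 1" by (simp add: norm_eq_sqrt_inner)
    then show "L * sqrt ?n * norm c \<le> L * sqrt ?n"
      using L by (intro mult_left_le) auto
    show "(\<Sum>\<tau>=1..t-1. \<eta> \<tau> * sigma2 W ^ (t - 1 - \<tau>)) \<le> (\<Sum>\<tau>=0..t-1. \<eta> \<tau> * sigma2 W ^ (t - \<tau> - 1))"
      unfolding diff_commute[of t 1] using step_size(1) sigma2_nonneg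
      by (intro sum_mono2) (auto intro!: mult_nonneg_nonneg intro: less_imp_le zero_le_power)
    show "0 \<le> L * sqrt ?n" using L by simp
    show "0 \<le> (\<Sum>\<tau>=1..t-1. \<eta> \<tau> * sigma2 W ^ (t - 1 - \<tau>))"
      using step_size(1) sigma2_nonneg
      by (intro sum_nonneg mult_nonneg_nonneg zero_le_power) (auto intro: less_imp_le)
  qed
  finally show ?thesis .
qed

lemma distance_to_mixed:
  assumes t: "t \<in> {1..T}"
  shows "N (x i t - mixed W x i t) \<le> 2 * disagreement t"
proof -
  have "mixed W x i t - average t = (\<Sum>j\<in>UNIV. W $ i $ j *\<^sub>R (x j t - average t))"
    using weights(5)[of i] by (simp add: mixed_def scaleR_diff_right sum_subtractf flip: scaleR_sum_left)
  then have "N (mixed W x i t - average t) \<le> (\<Sum>j\<in>UNIV. N (W $ i $ j *\<^sub>R (x j t - average t)))"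
    using is_norm_sum_le[OF norm, of "\<lambda>j. W $ i $ j *\<^sub>R (x j t - average t)" UNIV] by simp
  also have "\<dots> \<le> (\<Sum>j\<in>UNIV. W $ i $ j * disagreement t)"
    using weights(1) distance_to_average[OF t]
    by (intro sum_mono) (simp add: is_norm_simps[OF norm] mult_left_mono)
  also have "\<dots> = disagreement t" using weights(5)[of i] by (simp flip: sum_distrib_right)
  finally have "N (average t - mixed W x i t) \<le> disagreement t"
    by (simp add: is_norm_simps(4)[OF norm, of "average t"])
  then show ?thesis
    using is_norm_triangle[OF norm, of "x i t - average t" "average t - mixed W x i t"]
      distance_to_average[OF t, of i] by simp
qed

definition potential :: "(nat \<Rightarrow> real^'d) \<Rightarrow> nat \<Rightarrow> real" where
  "potential xs t = 1 / real CARD('n) * (\<Sum>i\<in>UNIV. bregman R gR (xs t) (x i t))"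

text \<open>
  Mixing does not increase the potential by separate convexity and the unit column sums, applying \<open>A\<close>
  to both arguments does not increase it, and replacing \<open>A x\<^sup>\<star>\<^sub>t\<close> by the new target costs the noise of
  the dynamics.
\<close>

lemma potential_drop:
  assumes t: "t \<in> {1..T}" and xs: "xs t \<in> X" "xs (t + 1) \<in> X"
  shows "1 / real CARD('n) *
      (\<Sum>i\<in>UNIV. bregman R gR (xs t) (mixed W x i t) - bregman R gR (xs t) (xh i (t + 1)))
    \<le> potential xs t - potential xs (t + 1) + K * N (xs (t + 1) - A *v xs t)"
proof -
  let ?n = "real CARD('n)" and ?D = "bregman R gR" and ?v = "K * N (xs (t + 1) - A *v xs t)"
  have "(\<Sum>i\<in>UNIV. ?D (xs t) (mixed W x i t)) \<le> (\<Sum>i\<in>UNIV. \<Sum>j\<in>UNIV. W $ i $ j * ?D (xs t) (x j t))"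
    unfolding mixed_def using t xs weights estimate_in_domain[of t]
    by (intro sum_mono separate_convexity) auto
  also have "\<dots> = (\<Sum>j\<in>UNIV. \<Sum>i\<in>UNIV. W $ i $ j * ?D (xs t) (x j t))" by (rule sum.swap)
  also have "\<dots> = (\<Sum>j\<in>UNIV. ?D (xs t) (x j t))" using weights(4) by (simp flip: sum_distrib_right)
  finally have mix: "(\<Sum>i\<in>UNIV. ?D (xs t) (mixed W x i t)) \<le> (\<Sum>j\<in>UNIV. ?D (xs t) (x j t))" .
  have "?D (xs (t + 1)) (x i (t + 1)) - ?v \<le> ?D (xs t) (xh i (t + 1))" for i
  proof -
    have "?D (xs (t + 1)) (x i (t + 1)) - ?v \<le> ?D (A *v xs t) (x i (t + 1))"
      using bregman_lipschitz[of "xs (t + 1)" "A *v xs t" "x i (t + 1)"] xs domain(3)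
        estimate_in_domain[of "t + 1" i] t by auto
    also have "\<dots> \<le> ?D (xs t) (xh i (t + 1))"
      unfolding run_step(2)[OF t] using xs run_step(3)[OF t] by (intro non_expansive(1)) auto
    finally show ?thesis .
  qed
  then have "(\<Sum>i\<in>UNIV. ?D (xs (t + 1)) (x i (t + 1)) - ?v) \<le> (\<Sum>i\<in>UNIV. ?D (xs t) (xh i (t + 1)))"
    by (rule sum_mono)
  then have "(\<Sum>i\<in>UNIV. ?D (xs t) (mixed W x i t) - ?D (xs t) (xh i (t + 1)))
      \<le> (\<Sum>j\<in>UNIV. ?D (xs t) (x j t)) - (\<Sum>i\<in>UNIV. ?D (xs (t + 1)) (x i (t + 1))) + ?n * ?v"
    using mix by (simp add: sum_subtractf)
  from mult_left_mono[OF this, of "1 / ?n"] show ?thesis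
    by (simp add: potential_def field_simps)
qed

lemma potential_bounds:
  assumes "t \<in> {1..T + 1}" "xs t \<in> X"
  shows "0 \<le> potential xs t" "potential xs t \<le> rad\<^sup>2"
proof -
  have b: "0 \<le> bregman R gR (xs t) (x i t)" "bregman R gR (xs t) (x i t) \<le> rad\<^sup>2" for i
    using bregman_ge_half_square[OF mirror_map(2) assms(2) estimate_in_domain[OF assms(1), of i]]
      bregman_le[OF assms(2) estimate_in_domain[OF assms(1)]] zero_le_power2[of "N (xs t - x i t)"]
    by (linarith, blast)
  show "0 \<le> potential xs t" unfolding potential_def using b(1) by (simp add: sum_nonneg)
  have "(\<Sum>i\<in>UNIV. bregman R gR (xs t) (x i t)) \<le> real CARD('n) * rad\<^sup>2"
    using b(2) sum_bounded_above[of UNIV "\<lambda>i. bregman R gR (xs t) (x i t)" "rad\<^sup>2"] by simp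
  then show "potential xs t \<le> rad\<^sup>2" unfolding potential_def by (simp add: field_simps)
qed

text \<open>
  Moving every agent's point to the average and then, loss by loss, to the point of the agent who
  owns the loss costs the disagreement twice.
\<close>

lemma global_loss_regret_le:
  assumes t: "t \<in> {1..T}"
    and lip: "\<And>i z y. z \<in> X \<Longrightarrow> y \<in> X \<Longrightarrow> \<bar>f i t z - f i t y\<bar> \<le> L * N (z - y)"
  shows "1 / real CARD('n) * (\<Sum>i\<in>UNIV. global_loss f t (x i t)) - global_loss f t z
    \<le> 2 * L * disagreement t + 1 / real CARD('n) * (\<Sum>i\<in>UNIV. f i t (x i t) - f i t z)"
proof -
  let ?n = "real CARD('n)"
  have L: "L \<ge> 0" using gradient_bound[OF t] dual_norm_nonneg[OF norm] order_trans by blast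
  have tT: "t \<in> {1..T + 1}" using t by simp
  have avg: "average t \<in> X" unfolding average_def
    using estimate_in_domain[OF tT] domain(1) by (intro convex_sum) auto
  have dev: "\<bar>f j t (x i t) - f j t (average t)\<bar> \<le> L * disagreement t" for i j
    using lip[OF estimate_in_domain[OF tT] avg, of j i] distance_to_average[OF t, of i] L
    by (meson mult_left_mono order_trans)
  have "f j t (x i t) \<le> f j t (x j t) + 2 * L * disagreement t" for i j
    using dev[of j i] dev[of j j] by linarith
  then have "(\<Sum>j\<in>UNIV. f j t (x i t)) \<le> (\<Sum>j\<in>UNIV. f j t (x j t) + 2 * L * disagreement t)" for i
    by (intro sum_mono)
  then have "global_loss f t (x i t) \<le> 1 / ?n * (\<Sum>j\<in>UNIV. f j t (x j t)) + 2 * L * disagreement t" for i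
    unfolding global_loss_def by (simp add: sum.distrib field_simps)
  then have "(\<Sum>i\<in>UNIV. global_loss f t (x i t))
      \<le> ?n * (1 / ?n * (\<Sum>j\<in>UNIV. f j t (x j t)) + 2 * L * disagreement t)"
    using sum_bounded_above[of "UNIV :: 'n set" "\<lambda>i. global_loss f t (x i t)"] by simp
  from mult_left_mono[OF this, of "1 / ?n"]
  have "1 / ?n * (\<Sum>i\<in>UNIV. global_loss f t (x i t))
      \<le> 1 / ?n * (\<Sum>j\<in>UNIV. f j t (x j t)) + 2 * L * disagreement t"
    by simp
  then show ?thesis by (simp add: global_loss_def sum_subtractf right_diff_distrib)
qed

text \<open>
  What remains of the randomness is the last sum: the received gradients are compared with the true
  ones only through their inner products with \<open>x i t - xs t\<close>.
\<close>

lemma dynamic_regret_le: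
  assumes xs: "\<And>t. t \<in> {1..T + 1} \<Longrightarrow> xs t \<in> X"
    and loss: "\<And>i t. t \<in> {1..T} \<Longrightarrow> convex_on X (f i t)"
      "\<And>i t. t \<in> {1..T} \<Longrightarrow> gradient_on X (f i t) (gf i t)"
    and lip: "\<And>i t z y. t \<in> {1..T} \<Longrightarrow> z \<in> X \<Longrightarrow> y \<in> X \<Longrightarrow> \<bar>f i t z - f i t y\<bar> \<le> L * N (z - y)"
  shows "dynamic_regret T f x xs \<le> E_track N A \<eta> T L K rad xs + E_net W \<eta> T L
    + (\<Sum>t=1..T. 1 / real CARD('n) * (\<Sum>i\<in>UNIV. (gf i t (x i t) - g i t) \<bullet> (x i t - xs t)))"
proof -
  let ?n = "real CARD('n)" and ?D = "bregman R gR"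
  let ?noise = "\<lambda>t. 1 / ?n * (\<Sum>i\<in>UNIV. (gf i t (x i t) - g i t) \<bullet> (x i t - xs t))"
  let ?v = "\<lambda>t. N (xs (t + 1) - A *v xs t)"
  \<comment> \<open>Of the four disagreements, two come from the global loss and two from the mirror step, where the
    gradient is received at \<open>x i t\<close> and applied at the mixed point.\<close>
  have round: "1 / ?n * (\<Sum>i\<in>UNIV. global_loss f t (x i t)) - global_loss f t (xs t)
      \<le> (potential xs t - potential xs (t + 1)) / \<eta> t + K / \<eta> (t + 1) * ?v t + L\<^sup>2 * (\<eta> t / 2)
        + 4 * L * disagreement t + ?noise t" if t: "t \<in> {1..T}" for t
  proof -
    have tT: "t \<in> {1..T + 1}" "t + 1 \<in> {1..T + 1}" using t by auto
    have L: "L \<ge> 0" using gradient_bound[OF t] dual_norm_nonneg[OF norm] order_trans by blast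
    let ?d = "\<lambda>i. ?D (xs t) (mixed W x i t) - ?D (xs t) (xh i (t + 1))"
    have "f i t (x i t) - f i t (xs t)
        \<le> (gf i t (x i t) - g i t) \<bullet> (x i t - xs t)
          + (2 * L * disagreement t + L\<^sup>2 * (\<eta> t / 2) + ?d i / \<eta> t)" for i
    proof -
      have "f i t (x i t) - f i t (xs t) \<le> gf i t (x i t) \<bullet> (x i t - xs t)"
        using convex_on_gradient_ineq[OF loss(1)[OF t] estimate_in_domain[OF tT(1)] xs[OF tT(1)] loss(2)[OF t]]
        by (simp add: inner_diff_right) (smt (verit))
      moreover have "gf i t (x i t) \<bullet> (x i t - xs t)
          = (gf i t (x i t) - g i t) \<bullet> (x i t - xs t) + g i t \<bullet> (x i t - xs t)"
        by (simp add: inner_diff_left)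
      moreover have "g i t \<bullet> (x i t - xs t)
          \<le> L * N (x i t - mixed W x i t) + L\<^sup>2 * (\<eta> t / 2) + ?d i / \<eta> t"
        by (rule mirror_step_linear_regret[OF norm domain(1) mirror_map mixed_in_domain[OF tT(1)]
              xs[OF tT(1)] run_step(1)[OF t] gradient_bound[OF t] step_size(1)])
      moreover have "L * N (x i t - mixed W x i t) \<le> L * (2 * disagreement t)"
        using L distance_to_mixed[OF t] by (intro mult_left_mono) auto
      ultimately show ?thesis by simp
    qed
    then have "(\<Sum>i\<in>UNIV. f i t (x i t) - f i t (xs t))
        \<le> (\<Sum>i\<in>UNIV. (gf i t (x i t) - g i t) \<bullet> (x i t - xs t)
          + (2 * L * disagreement t + L\<^sup>2 * (\<eta> t / 2) + ?d i / \<eta> t))"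
      by (rule sum_mono)
    from mult_left_mono[OF this, of "1 / ?n"]
    have local: "1 / ?n * (\<Sum>i\<in>UNIV. f i t (x i t) - f i t (xs t))
        \<le> ?noise t + (2 * L * disagreement t + L\<^sup>2 * (\<eta> t / 2))
          + (1 / ?n * (\<Sum>i\<in>UNIV. ?d i)) / \<eta> t"
      by (simp add: sum.distrib distrib_left flip: sum_divide_distrib)
    have "(1 / ?n * (\<Sum>i\<in>UNIV. ?d i)) / \<eta> t
        \<le> (potential xs t - potential xs (t + 1) + K * ?v t) / \<eta> t"
      using potential_drop[OF t xs[OF tT(1)] xs[OF tT(2)]] step_size(1)[of t]
      by (intro divide_right_mono) auto
    also have "\<dots> \<le> (potential xs t - potential xs (t + 1)) / \<eta> t + K / \<eta> (t + 1) * ?v t"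
    proof -
      have "\<eta> (t + 1) \<le> \<eta> t" using decseqD[OF step_size(2), of t "t + 1"] by simp
      moreover have "0 \<le> K * ?v t"
        using bregman_lipschitz[OF xs[OF tT(2)] domain(3)[OF xs[OF tT(1)]] domain(2)] by linarith
      ultimately have "K * ?v t / \<eta> t \<le> K * ?v t / \<eta> (t + 1)"
        using step_size(1) by (intro divide_left_mono) auto
      then show ?thesis by (simp add: add_divide_distrib)
    qed
    finally show ?thesis
      using local global_loss_regret_le[where f = f and z = "xs t", OF t lip[OF t]] by linarith
  qed
  have "dynamic_regret T f x xs
      = (\<Sum>t=1..T. 1 / ?n * (\<Sum>i\<in>UNIV. global_loss f t (x i t)) - global_loss f t (xs t))"
    unfolding dynamic_regret_def
    by (subst sum.swap) (simp add: sum_subtractf sum_distrib_left)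
  also have "\<dots> \<le> (\<Sum>t=1..T. (potential xs t - potential xs (t + 1)) / \<eta> t
        + K / \<eta> (t + 1) * ?v t + L\<^sup>2 * (\<eta> t / 2) + 4 * L * disagreement t + ?noise t)"
    by (intro sum_mono round)
  finally have "dynamic_regret T f x xs
      \<le> (\<Sum>t=1..T. (potential xs t - potential xs (t + 1)) / \<eta> t)
      + (\<Sum>t=1..T. K / \<eta> (t + 1) * ?v t) + L\<^sup>2 * (\<Sum>t=1..T. \<eta> t / 2)
      + 4 * L * (\<Sum>t=1..T. disagreement t) + (\<Sum>t=1..T. ?noise t)"
    by (simp only: sum.distrib sum_distrib_left)
  moreover have "4 * L * (\<Sum>t=1..T. disagreement t) = E_net W \<eta> T L"
    by (simp add: disagreement_def E_net_def power2_eq_square mult.assoc flip: sum_distrib_left)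
  moreover have "(\<Sum>t=1..T. (potential xs t - potential xs (t + 1)) / \<eta> t) \<le> rad\<^sup>2 / \<eta> (T + 1)"
    using potential_bounds xs by (intro weighted_telescoping_le step_size) auto
  moreover have "rad\<^sup>2 / \<eta> (T + 1) \<le> 2 * rad\<^sup>2 / \<eta> (T + 1)"
    using step_size(1)[of "T + 1"] by (intro divide_right_mono) auto
  ultimately show ?thesis unfolding E_track_def by linarith
qed

end

end

end

section \<open>Azuma's inequality\<close>

text \<open>
  The two-point case of Hoeffding's lemma: \<open>cosh x\<close> is the moment generating function of a fair sign.
\<close>

lemma cosh_le_exp_half_square:
  fixes x :: real
  shows "cosh x \<le> exp (x\<^sup>2 / 2)"
proof -
  have *: "cosh x \<le> exp (x\<^sup>2 / 2)" if "x \<ge> 0" for x :: real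
  proof -
    have pos: "1 + 1/2 * (exp (2 * x) - 1) > 0" using that by (simp add: add_pos_nonneg)
    \<comment> \<open>Probability \<open>1/2\<close> for each end of an interval of length \<open>2\<close>.\<close>
    have "- (2 * x) * (1/2) + ln (1 + 1/2 * (exp (2 * x) - 1)) \<le> (2 * x)\<^sup>2 / 8"
      using that by (intro Hoeffdings_lemma_aux) auto
    then have "exp (- x + ln (1 + 1/2 * (exp (2 * x) - 1))) \<le> exp (x\<^sup>2 / 2)"
      by (simp add: power2_eq_square)
    also have "exp (- x + ln (1 + 1/2 * (exp (2 * x) - 1))) = exp (- x) * (1 + 1/2 * (exp (2 * x) - 1))"
      using pos by (simp only: exp_add exp_ln)
    also have "\<dots> = cosh x"
      by (simp add: cosh_def field_simps flip: exp_add)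
    finally show ?thesis .
  qed
  show ?thesis using *[of x] *[of "- x"] by (cases "x \<ge> 0") auto
qed

text \<open>
  The convex function \<open>exp\<close> lies below its chord over \<open>[- b, b]\<close>, whose value at \<open>0\<close> is \<open>cosh b\<close> and whose
  slope is \<open>sinh b / b\<close>. The slope is immaterial once \<open>d\<close> is averaged with mean \<open>0\<close>.
\<close>

lemma exp_le_chord:
  fixes b d :: real
  assumes "b > 0" "\<bar>d\<bar> \<le> b"
  shows "exp d \<le> exp (b\<^sup>2 / 2) + (sinh b / b) * d"
proof -
  define p where "p = (b + d) / (2 * b)"
  have p: "0 \<le> p" "p \<le> 1" using assms by (auto simp: p_def field_simps abs_le_iff)
  have d: "d = (1 - p) * (- b) + p * b" using assms(1) by (simp add: p_def field_simps)
  have "convex_on UNIV (\<lambda>x::real. exp x)" using convex_on_exp[of 1] by simp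
  from convex_onD[OF this p, of "- b" b] have "exp ((1 - p) * (- b) + p * b) \<le> (1 - p) * exp (- b) + p * exp b"
    by simp
  then have "exp d \<le> (1 - p) * exp (- b) + p * exp b" by (simp only: d[symmetric])
  also have "\<dots> = cosh b + (sinh b / b) * d"
    using assms(1) by (simp add: p_def cosh_def sinh_def field_simps)
  finally show ?thesis using cosh_le_exp_half_square[of b] by simp
qed

text \<open>
  Multiplying by the chord bound at each step and using that a martingale difference is orthogonal
  to everything known before it bounds the moment generating function of the sum.
\<close>

lemma (in prob_space) martingale_difference_mgf_le:
  fixes F :: "nat \<Rightarrow> 'a measure" and D :: "nat \<Rightarrow> 'a \<Rightarrow> real"
  assumes filt: "filtration (space M) F" "\<And>t. subalgebra M (F t)"
    and meas: "\<And>t. t \<in> {1..T} \<Longrightarrow> D t \<in> borel_measurable (F t)"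
    and bound: "\<And>t. t \<in> {1..T} \<Longrightarrow> AE \<omega> in M. \<bar>D t \<omega>\<bar> \<le> b"
    and diff: "\<And>t. t \<in> {1..T} \<Longrightarrow> AE \<omega> in M. real_cond_exp M (F (t - 1)) (D t) \<omega> = 0"
    and pos: "b > 0" "l > 0"
  shows "integrable M (\<lambda>\<omega>. exp (l * (\<Sum>t=1..T. D t \<omega>)))
    \<and> (\<integral>\<omega>. exp (l * (\<Sum>t=1..T. D t \<omega>)) \<partial>M) \<le> exp (real T * (l * b)\<^sup>2 / 2)"
  using meas bound diff
proof (induction T)
  case 0
  then show ?case by (simp add: prob_space)
next
  case (Suc T)
  let ?S = "\<lambda>\<omega>. \<Sum>t=1..T. D t \<omega>" and ?d = "D (Suc T)"
  have IH: "integrable M (\<lambda>\<omega>. exp (l * ?S \<omega>))"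
      "(\<integral>\<omega>. exp (l * ?S \<omega>) \<partial>M) \<le> exp (real T * (l * b)\<^sup>2 / 2)"
    using Suc by auto
  have SF: "?S \<in> borel_measurable (F T)"
  proof (intro borel_measurable_sum)
    fix t assume t: "t \<in> {1..T}"
    have "sets (F t) \<subseteq> sets (F T)" "space (F t) = space (F T)"
      using filtration.sets_F_mono[OF filt(1), of t T] filtration.space_F[OF filt(1)] t by auto
    then show "D t \<in> borel_measurable (F T)"
      using Suc.prems(1)[of t] t by (auto simp: measurable_def)
  qed
  then have eF: "(\<lambda>\<omega>. exp (l * ?S \<omega>)) \<in> borel_measurable (F T)" by measurable
  have [measurable]: "?S \<in> borel_measurable M" by (rule measurable_from_subalg[OF filt(2) SF])
  have [measurable]: "?d \<in> borel_measurable M"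
    by (rule measurable_from_subalg[OF filt(2) Suc.prems(1)]) simp
  have bnd: "AE \<omega> in M. \<bar>?d \<omega>\<bar> \<le> b" by (rule Suc.prems(2)) simp
  interpret sub: finite_measure_subalgebra M "F T"
    by standard (rule filt(2))
  have int_d: "integrable M (\<lambda>\<omega>. exp (l * ?S \<omega>) * ?d \<omega>)"
  proof (rule Bochner_Integration.integrable_bound[OF integrable_mult_right[OF IH(1), of b]])
    show "AE \<omega> in M. norm (exp (l * ?S \<omega>) * ?d \<omega>) \<le> norm (b * exp (l * ?S \<omega>))"
      using bnd pos by (auto simp: abs_mult mult.commute)
  qed measurable
  have "(\<integral>\<omega>. exp (l * ?S \<omega>) * ?d \<omega> \<partial>M)
      = (\<integral>\<omega>. exp (l * ?S \<omega>) * real_cond_exp M (F T) ?d \<omega> \<partial>M)"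
    by (rule sub.real_cond_exp_intg(2)[symmetric]) (use int_d eF in auto)
  also have "\<dots> = (\<integral>\<omega>. 0 \<partial>M)"
  proof (rule integral_cong_AE)
    show "AE \<omega> in M. exp (l * ?S \<omega>) * real_cond_exp M (F T) ?d \<omega> = 0"
      using Suc.prems(3)[of "Suc T"] by auto
  qed measurable
  finally have orth: "(\<integral>\<omega>. exp (l * ?S \<omega>) * ?d \<omega> \<partial>M) = 0" by simp
  let ?c = "exp ((l * b)\<^sup>2 / 2)" and ?s = "sinh (l * b) / (l * b) * l"
  let ?u = "\<lambda>\<omega>. ?c * exp (l * ?S \<omega>) + ?s * (exp (l * ?S \<omega>) * ?d \<omega>)"
  have u_int: "integrable M ?u" using IH(1) int_d by auto
  have step: "AE \<omega> in M. exp (l * (\<Sum>t=1..Suc T. D t \<omega>)) \<le> ?u \<omega>"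
    using bnd
  proof eventually_elim
    fix \<omega> assume "\<bar>?d \<omega>\<bar> \<le> b"
    then have "exp (l * ?d \<omega>) \<le> ?c + sinh (l * b) / (l * b) * (l * ?d \<omega>)"
      using pos by (intro exp_le_chord) (auto simp: abs_mult)
    then have "exp (l * ?S \<omega>) * exp (l * ?d \<omega>)
        \<le> exp (l * ?S \<omega>) * (?c + sinh (l * b) / (l * b) * (l * ?d \<omega>))"
      by (intro mult_left_mono) auto
    moreover have "exp (l * (\<Sum>t=1..Suc T. D t \<omega>)) = exp (l * ?S \<omega>) * exp (l * ?d \<omega>)"
      by (simp add: distrib_left exp_add)
    ultimately show "exp (l * (\<Sum>t=1..Suc T. D t \<omega>)) \<le> ?u \<omega>"
      by (simp only: distrib_left mult_ac)
  qed
  have int: "integrable M (\<lambda>\<omega>. exp (l * (\<Sum>t=1..Suc T. D t \<omega>)))"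
  proof (rule Bochner_Integration.integrable_bound[OF u_int])
    show "AE \<omega> in M. norm (exp (l * (\<Sum>t=1..Suc T. D t \<omega>))) \<le> norm (?u \<omega>)"
      using step by eventually_elim auto
    have "(\<lambda>\<omega>. ?S \<omega> + ?d \<omega>) \<in> borel_measurable M" by measurable
    then have [measurable]: "(\<lambda>\<omega>. \<Sum>t=1..Suc T. D t \<omega>) \<in> borel_measurable M" by simp
    show "(\<lambda>\<omega>. exp (l * (\<Sum>t=1..Suc T. D t \<omega>))) \<in> borel_measurable M" by measurable
  qed
  have "(\<integral>\<omega>. exp (l * (\<Sum>t=1..Suc T. D t \<omega>)) \<partial>M) \<le> (\<integral>\<omega>. ?u \<omega> \<partial>M)"
    by (rule integral_mono_AE[OF int u_int step])
  also have "\<dots> = ?c * (\<integral>\<omega>. exp (l * ?S \<omega>) \<partial>M)" using IH(1) int_d orth by simp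
  also have "\<dots> \<le> ?c * exp (real T * (l * b)\<^sup>2 / 2)" using IH(2) by (intro mult_left_mono) auto
  also have "\<dots> = exp (real (Suc T) * (l * b)\<^sup>2 / 2)" by (simp add: exp_add[symmetric] field_simps)
  finally show ?case using int by blast
qed

text \<open>
  Markov's inequality for the exponential of the sum. The degenerate cases, in which the sum vanishes
  almost surely, are separate because the optimal exponent divides by \<open>T b\<close>.
\<close>

lemma (in prob_space) azuma_quantile:
  fixes F :: "nat \<Rightarrow> 'a measure" and D :: "nat \<Rightarrow> 'a \<Rightarrow> real"
  assumes filt: "filtration (space M) F" "\<And>t. subalgebra M (F t)"
    and meas: "\<And>t. t \<in> {1..T} \<Longrightarrow> D t \<in> borel_measurable (F t)"
    and bound: "\<And>t. t \<in> {1..T} \<Longrightarrow> AE \<omega> in M. \<bar>D t \<omega>\<bar> \<le> b"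
    and diff: "\<And>t. t \<in> {1..T} \<Longrightarrow> AE \<omega> in M. real_cond_exp M (F (t - 1)) (D t) \<omega> = 0"
    and b: "b \<ge> 0" and \<delta>: "0 < \<delta>" "\<delta> < 1"
  shows "prob {\<omega> \<in> space M. (\<Sum>t=1..T. D t \<omega>) \<le> b * sqrt (- 2 * real T * ln \<delta>)} \<ge> 1 - \<delta>"
proof (cases "b = 0 \<or> T = 0")
  case True
  have [measurable]: "(\<lambda>\<omega>. \<Sum>t=1..T. D t \<omega>) \<in> borel_measurable M"
    using meas measurable_from_subalg[OF filt(2)] by (intro borel_measurable_sum) auto
  have "AE \<omega> in M. \<forall>t\<in>{1..T}. \<bar>D t \<omega>\<bar> \<le> b"
    by (intro AE_finite_allI bound) auto
  then have "AE \<omega> in M. (\<Sum>t=1..T. D t \<omega>) \<le> b * sqrt (- 2 * real T * ln \<delta>)"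
    by eventually_elim (use True in auto)
  then have "prob {\<omega> \<in> space M. (\<Sum>t=1..T. D t \<omega>) \<le> b * sqrt (- 2 * real T * ln \<delta>)} = 1"
    by (subst prob_Collect_eq_1) measurable
  then show ?thesis using \<delta> by simp
next
  case False
  then have b: "b > 0" and T: "T > 0" using b by auto
  let ?S = "\<lambda>\<omega>. \<Sum>t=1..T. D t \<omega>"
  have [measurable]: "?S \<in> borel_measurable M"
    using meas measurable_from_subalg[OF filt(2)] by (intro borel_measurable_sum) auto
  define r where "r = sqrt (- 2 * real T * ln \<delta>)"
  have r: "r > 0" "r\<^sup>2 = - 2 * real T * ln \<delta>"
    using \<delta> T by (auto simp: r_def mult_less_0_iff zero_less_mult_iff intro!: real_sqrt_pow2 mult_nonneg_nonpos)
  define l where "l = r / (real T * b)"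
  have l: "l > 0" using r b T by (simp add: l_def)
  note mgf = martingale_difference_mgf_le[OF filt meas bound diff b l]
  \<comment> \<open>The choice of \<open>l\<close> minimises the exponent below over all positive values.\<close>
  have expo: "real T * (l * b)\<^sup>2 / 2 - l * (b * r) = ln \<delta>"
  proof -
    have lb: "l * b = r / real T" using b by (simp add: l_def)
    have "real T * (l * b)\<^sup>2 / 2 - (l * b) * r = - r\<^sup>2 / (2 * real T)"
      unfolding lb using T by (simp add: power2_eq_square field_simps)
    then show ?thesis using T r(2) by (simp add: mult.assoc)
  qed
  have "prob {\<omega> \<in> space M. b * r \<le> ?S \<omega>}
      \<le> prob {\<omega> \<in> space M. exp (l * (b * r)) \<le> exp (l * ?S \<omega>)}"
  proof (rule finite_measure_mono)
    show "{\<omega> \<in> space M. b * r \<le> ?S \<omega>} \<subseteq> {\<omega> \<in> space M. exp (l * (b * r)) \<le> exp (l * ?S \<omega>)}"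
      using l by auto
  qed measurable
  also have "\<dots> \<le> (\<integral>\<omega>. exp (l * ?S \<omega>) \<partial>M) / exp (l * (b * r))"
    using mgf by (intro integral_Markov_inequality_measure[where A = "{}"]) auto
  also have "\<dots> \<le> exp (real T * (l * b)\<^sup>2 / 2) / exp (l * (b * r))"
    using mgf by (intro divide_right_mono) auto
  also have "\<dots> = \<delta>" using \<delta> by (simp flip: exp_diff add: expo)
  finally have "prob {\<omega> \<in> space M. b * r \<le> ?S \<omega>} \<le> \<delta>" .
  moreover have "prob {\<omega> \<in> space M. \<not> b * r \<le> ?S \<omega>} = 1 - prob {\<omega> \<in> space M. b * r \<le> ?S \<omega>}"
    by (rule prob_neg) measurable
  moreover have "prob {\<omega> \<in> space M. \<not> b * r \<le> ?S \<omega>} \<le> prob {\<omega> \<in> space M. ?S \<omega> \<le> b * r}"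
  proof (rule finite_measure_mono)
    show "{\<omega> \<in> space M. \<not> b * r \<le> ?S \<omega>} \<subseteq> {\<omega> \<in> space M. ?S \<omega> \<le> b * r}" by auto
  qed measurable
  ultimately show ?thesis unfolding r_def by simp
qed

text \<open>
  For a bounded adapted sequence minus its one-step predictions. The predictions obey the same bound
  as the sequence, so the differences are bounded by twice that bound.
\<close>

lemma (in prob_space) azuma_centred_quantile:
  fixes F :: "nat \<Rightarrow> 'a measure" and G :: "nat \<Rightarrow> 'a \<Rightarrow> real"
  assumes filt: "filtration (space M) F" "\<And>t. subalgebra M (F t)"
    and meas: "\<And>t. t \<in> {1..T} \<Longrightarrow> G t \<in> borel_measurable (F t)"
    and bound: "\<And>t. t \<in> {1..T} \<Longrightarrow> AE \<omega> in M. \<bar>G t \<omega>\<bar> \<le> c"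
    and c: "c \<ge> 0" and \<delta>: "0 < \<delta>" "\<delta> < 1"
  shows "prob {\<omega> \<in> space M. (\<Sum>t=1..T. real_cond_exp M (F (t - 1)) (G t) \<omega> - G t \<omega>)
    \<le> 2 * c * sqrt (- 2 * real T * ln \<delta>)} \<ge> 1 - \<delta>"
proof (rule azuma_quantile[OF filt])
  fix t assume t: "t \<in> {1..T}"
  interpret sub: finite_measure_subalgebra M "F (t - 1)"
    by standard (rule filt(2))
  have GM [measurable]: "G t \<in> borel_measurable M" by (rule measurable_from_subalg[OF filt(2) meas[OF t]])
  have int: "integrable M (G t)" using bound[OF t] by (intro integrable_const_bound[of _ c]) auto
  have "sets (F (t - 1)) \<subseteq> sets (F t)" "space (F (t - 1)) = space (F t)"
    using filtration.sets_F_mono[OF filt(1), of "t - 1" t] filtration.space_F[OF filt(1)] by auto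
  moreover have "real_cond_exp M (F (t - 1)) (G t) \<in> borel_measurable (F (t - 1))" by simp
  ultimately have "real_cond_exp M (F (t - 1)) (G t) \<in> borel_measurable (F t)"
    by (auto simp: measurable_def)
  then show "(\<lambda>\<omega>. real_cond_exp M (F (t - 1)) (G t) \<omega> - G t \<omega>) \<in> borel_measurable (F t)"
    using meas[OF t] by measurable
  have "AE \<omega> in M. G t \<omega> \<le> c" "AE \<omega> in M. G t \<omega> \<ge> - c"
    using bound[OF t] by (eventually_elim, auto)+
  from sub.real_cond_exp_le_c[OF int this(1)] sub.real_cond_exp_ge_c[OF int this(2)] bound[OF t]
  show "AE \<omega> in M. \<bar>real_cond_exp M (F (t - 1)) (G t) \<omega> - G t \<omega>\<bar> \<le> 2 * c"
    by eventually_elim auto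
  have intC: "integrable M (real_cond_exp M (F (t - 1)) (G t))" by (rule sub.real_cond_exp_int(1)[OF int])
  have "AE \<omega> in M. real_cond_exp M (F (t - 1)) (real_cond_exp M (F (t - 1)) (G t)) \<omega>
      = real_cond_exp M (F (t - 1)) (G t) \<omega>"
    by (rule sub.real_cond_exp_F_meas[OF intC]) simp
  with sub.real_cond_exp_diff[OF intC int]
  show "AE \<omega> in M. real_cond_exp M (F (t - 1)) (\<lambda>\<omega>. real_cond_exp M (F (t - 1)) (G t) \<omega> - G t \<omega>) \<omega> = 0"
    by eventually_elim simp
qed (use c \<delta> in auto)

text \<open>
  A known factor may be pulled out of a conditional expectation, here coordinate by coordinate.
\<close>

lemma (in sigma_finite_subalgebra) real_cond_exp_inner:
  fixes g h :: "'a \<Rightarrow> real^'d"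
  assumes [measurable]: "h \<in> borel_measurable F" "g \<in> borel_measurable M"
    and int: "\<And>k. integrable M (\<lambda>\<omega>. h \<omega> $ k * g \<omega> $ k)"
  shows "AE \<omega> in M. real_cond_exp M F (\<lambda>\<omega>. g \<omega> \<bullet> h \<omega>) \<omega> = vec_cond_exp M F g \<omega> \<bullet> h \<omega>"
proof -
  have nth [measurable]: "(\<lambda>z. z $ k) \<in> borel_measurable borel" for k :: 'd
    by (intro borel_measurable_continuous_onI continuous_intros)
  have [measurable]: "(\<lambda>\<omega>. h \<omega> $ k) \<in> borel_measurable F" "(\<lambda>\<omega>. g \<omega> $ k) \<in> borel_measurable M" for k
    by (rule measurable_compose[OF _ nth], fact)+
  have "AE \<omega> in M. real_cond_exp M F (\<lambda>\<omega>. h \<omega> $ k * g \<omega> $ k) \<omega>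
      = h \<omega> $ k * real_cond_exp M F (\<lambda>\<omega>. g \<omega> $ k) \<omega>" for k
    using int by (intro real_cond_exp_mult) auto
  then have "AE \<omega> in M. \<forall>k\<in>UNIV. real_cond_exp M F (\<lambda>\<omega>. h \<omega> $ k * g \<omega> $ k) \<omega>
      = h \<omega> $ k * real_cond_exp M F (\<lambda>\<omega>. g \<omega> $ k) \<omega>"
    by (intro AE_finite_allI) auto
  moreover have "AE \<omega> in M. real_cond_exp M F (\<lambda>\<omega>. \<Sum>k\<in>UNIV. h \<omega> $ k * g \<omega> $ k) \<omega>
      = (\<Sum>k\<in>UNIV. real_cond_exp M F (\<lambda>\<omega>. h \<omega> $ k * g \<omega> $ k) \<omega>)"
    using int by (rule real_cond_exp_sum)
  ultimately show ?thesis
    by eventually_elim (simp add: inner_vec_def vec_cond_exp_def mult.commute)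
qed

section \<open>Measurability of random Lipschitz functions along random points\<close>

text \<open>
  A Lipschitz function is recovered on its domain from its values on a countable dense subset by
  the McShane formula \<open>f x = inf\<^sub>d (f d + L N(x - d))\<close>, a countable infimum of functions that
  are measurable in the sample point.
\<close>

lemma borel_measurable_lipschitz_compose:
  fixes X :: "'a::euclidean_space set" and N :: "'a \<Rightarrow> real"
  assumes N: "continuous_on UNIV N" "N 0 = 0" "\<And>x. 0 \<le> N x"
    and f: "\<And>z. z \<in> X \<Longrightarrow> (\<lambda>\<omega>. f \<omega> z) \<in> borel_measurable M"
    and lip: "\<And>\<omega> z y. \<omega> \<in> space M \<Longrightarrow> z \<in> X \<Longrightarrow> y \<in> X \<Longrightarrow> \<bar>f \<omega> z - f \<omega> y\<bar> \<le> L * N (z - y)"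
    and x: "x \<in> borel_measurable M" "\<And>\<omega>. \<omega> \<in> space M \<Longrightarrow> x \<omega> \<in> X"
  shows "(\<lambda>\<omega>. f \<omega> (x \<omega>)) \<in> borel_measurable M"
proof (cases "space M = {}")
  case True
  then show ?thesis by (simp add: measurable_def)
next
  case False
  obtain D where D: "countable D" "D \<subseteq> X" "X \<subseteq> closure D" using separable by blast
  have "X \<noteq> {}" using False x(2) by blast
  then have D_ne: "D \<noteq> {}" using D(3) by auto
  have lower: "f \<omega> (x \<omega>) \<le> f \<omega> d + L * N (x \<omega> - d)" if "\<omega> \<in> space M" "d \<in> D" for \<omega> d
    using lip[OF that(1) x(2)[OF that(1)], of d] that D(2) by fastforce
  have eq: "f \<omega> (x \<omega>) = (INF d\<in>D. f \<omega> d + L * N (x \<omega> - d))" if \<omega>: "\<omega> \<in> space M" for \<omega>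
  proof (rule antisym)
    show "f \<omega> (x \<omega>) \<le> (INF d\<in>D. f \<omega> d + L * N (x \<omega> - d))"
      using D_ne lower[OF \<omega>] by (intro cINF_greatest) auto
    show "(INF d\<in>D. f \<omega> d + L * N (x \<omega> - d)) \<le> f \<omega> (x \<omega>)"
    proof (rule field_le_epsilon)
      fix e :: real assume "e > 0"
      obtain s where s: "\<And>k::nat. s k \<in> D" "s \<longlonglongrightarrow> x \<omega>"
        using D(3) x(2)[OF \<omega>] closure_sequential[of "x \<omega>" D] by blast
      have "(\<lambda>k. N (x \<omega> - s k)) \<longlonglongrightarrow> N (x \<omega> - x \<omega>)"
        using N(1) s(2) by (intro continuous_on_tendsto_compose[OF N(1)] tendsto_intros) auto
      then have "(\<lambda>k. 2 * L * N (x \<omega> - s k)) \<longlonglongrightarrow> 2 * L * 0"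
        by (intro tendsto_intros) (simp add: N(2))
      then have "\<forall>\<^sub>F k in sequentially. 2 * L * N (x \<omega> - s k) < e"
        using \<open>e > 0\<close> by (intro order_tendstoD(2)[where y = "2 * L * 0"]) auto
      then obtain k where k: "2 * L * N (x \<omega> - s k) < e" by (auto simp: eventually_sequentially)
      have "(INF d\<in>D. f \<omega> d + L * N (x \<omega> - d)) \<le> f \<omega> (s k) + L * N (x \<omega> - s k)"
        using s(1) lower[OF \<omega>] by (intro cINF_lower bdd_belowI2) auto
      also have "f \<omega> (s k) \<le> f \<omega> (x \<omega>) + L * N (x \<omega> - s k)"
        using lip[OF \<omega> x(2)[OF \<omega>], of "s k"] s(1)[of k] D(2) by fastforce
      finally show "(INF d\<in>D. f \<omega> d + L * N (x \<omega> - d)) \<le> f \<omega> (x \<omega>) + e" using k by simp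
    qed
  qed
  have [measurable]: "N \<in> borel_measurable borel" using N(1) by (rule borel_measurable_continuous_onI)
  note x(1)[measurable]
  have "(\<lambda>\<omega>. INF d\<in>D. f \<omega> d + L * N (x \<omega> - d)) \<in> borel_measurable M"
  proof (rule borel_measurable_cINF_real[OF D(1)])
    fix d assume "d \<in> D"
    then have [measurable]: "(\<lambda>\<omega>. f \<omega> d) \<in> borel_measurable M" using f D(2) by blast
    show "(\<lambda>\<omega>. f \<omega> d + L * N (x \<omega> - d)) \<in> borel_measurable M" by measurable
  qed
  then show ?thesis using eq by (subst measurable_cong[OF eq]) auto
qed

section \<open>The regret bound with high probability\<close>

theorem theorem1:
  fixes M :: "'w measure" and F :: "nat \<Rightarrow> 'w measure"
    and X :: "(real^'d) set" and N :: "real^'d \<Rightarrow> real"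
    and R :: "real^'d \<Rightarrow> real" and gR :: "real^'d \<Rightarrow> real^'d"
    and E :: "'n::finite \<Rightarrow> 'n \<Rightarrow> bool" and W :: "real^'n^'n" and A :: "real^'d^'d"
    and f :: "'w \<Rightarrow> 'n \<Rightarrow> nat \<Rightarrow> real^'d \<Rightarrow> real"
    and gf :: "'w \<Rightarrow> 'n \<Rightarrow> nat \<Rightarrow> real^'d \<Rightarrow> real^'d"
    and g xh x :: "'w \<Rightarrow> 'n \<Rightarrow> nat \<Rightarrow> real^'d"
    and xs v :: "'w \<Rightarrow> nat \<Rightarrow> real^'d"
    and \<eta> :: "nat \<Rightarrow> real" and T :: nat and L K rad \<delta> :: real
  assumes norm: "is_norm N"
    and domain: "compact X" "convex X" "0 \<in> X" "(\<lambda>z. A *v z) ` X \<subseteq> X"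
    and mirror_map: "gradient_on X R gR" "strongly_convex_wrt N X R gR"
    and radius: "rad \<ge> 0" "rad\<^sup>2 = (SUP (z, y)\<in>X \<times> X. bregman R gR z y)"
    and prob: "prob_space M" "filtration (space M) F" "\<And>t. subalgebra M (F t)"
    and loss: "\<And>\<omega> i t. \<omega> \<in> space M \<Longrightarrow> t \<in> {1..T} \<Longrightarrow> convex_on X (f \<omega> i t)"
      "\<And>\<omega> i t. \<omega> \<in> space M \<Longrightarrow> t \<in> {1..T} \<Longrightarrow> gradient_on X (f \<omega> i t) (gf \<omega> i t)"
      "\<And>i t z. t \<in> {1..T} \<Longrightarrow> z \<in> X \<Longrightarrow> (\<lambda>\<omega>. f \<omega> i t z) \<in> borel_measurable (F (t - 1))"
    and target: "\<And>\<omega> t. \<omega> \<in> space M \<Longrightarrow> t \<in> {1..T} \<Longrightarrow>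
        is_arg_min (global_loss (f \<omega>) t) (\<lambda>z. z \<in> X) (xs \<omega> t)"
      "\<And>\<omega> t. \<omega> \<in> space M \<Longrightarrow> t \<in> {1..T + 1} \<Longrightarrow> xs \<omega> t \<in> X"
      "\<And>\<omega> t. \<omega> \<in> space M \<Longrightarrow> t \<in> {1..T} \<Longrightarrow> xs \<omega> (t + 1) = A *v xs \<omega> t + v \<omega> t"
      "\<And>t. t \<in> {1..T + 1} \<Longrightarrow> (\<lambda>\<omega>. xs \<omega> t) \<in> borel_measurable (F (t - 1))"
    and step_size: "\<And>t. \<eta> t > 0" "decseq \<eta>"
    and algorithm: "\<And>\<omega>. \<omega> \<in> space M \<Longrightarrow>
        mirror_descent_run X R gR W A \<eta> T (g \<omega>) (xh \<omega>) (x \<omega>)"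
      "\<And>i t. t \<in> {1..T} \<Longrightarrow> (\<lambda>\<omega>. x \<omega> i t) \<in> borel_measurable (F (t - 1))"
    and stochastic_gradient:
      "\<And>i t. t \<in> {1..T} \<Longrightarrow> (\<lambda>\<omega>. g \<omega> i t) \<in> borel_measurable (F t)"
      "\<And>i t. t \<in> {1..T} \<Longrightarrow>
         AE \<omega> in M. vec_cond_exp M (F (t - 1)) (\<lambda>\<omega>. g \<omega> i t) \<omega> = gf \<omega> i t (x \<omega> i t)"
      "\<And>i t. t \<in> {1..T} \<Longrightarrow> AE \<omega> in M. dual_norm N (g \<omega> i t) \<le> L"
    and lipschitz: "\<And>\<omega> i t z y. \<omega> \<in> space M \<Longrightarrow> t \<in> {1..T} \<Longrightarrow> z \<in> X \<Longrightarrow> y \<in> X \<Longrightarrow>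
        \<bar>f \<omega> i t z - f \<omega> i t y\<bar> \<le> L * N (z - y)"
    and graph: "symp E" "irreflp E" "\<And>i j. E\<^sup>*\<^sup>* i j"
    and weights: "\<And>i j. W $ i $ j \<ge> 0" "\<And>i j. i \<noteq> j \<Longrightarrow> W $ i $ j > 0 \<longleftrightarrow> E i j"
      "transpose W = W" "\<And>j. (\<Sum>i\<in>UNIV. W $ i $ j) = 1" "\<And>i. (\<Sum>j\<in>UNIV. W $ i $ j) = 1"
      "\<And>i. W $ i $ i > 0"
    and separate_convexity: "\<And>z (y :: 'n \<Rightarrow> real^'d) (\<alpha> :: 'n \<Rightarrow> real).
        z \<in> X \<Longrightarrow> (\<And>i. y i \<in> X) \<Longrightarrow> (\<And>i. \<alpha> i \<ge> 0) \<Longrightarrow> (\<Sum>i\<in>UNIV. \<alpha> i) = 1 \<Longrightarrow>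
        bregman R gR z (\<Sum>i\<in>UNIV. \<alpha> i *\<^sub>R y i) \<le> (\<Sum>i\<in>UNIV. \<alpha> i * bregman R gR z (y i))"
    and bregman_lipschitz: "\<And>z y w. z \<in> X \<Longrightarrow> y \<in> X \<Longrightarrow> w \<in> X \<Longrightarrow>
        \<bar>bregman R gR z w - bregman R gR y w\<bar> \<le> K * N (z - y)"
    and non_expansive:
      "\<And>z y. z \<in> X \<Longrightarrow> y \<in> X \<Longrightarrow> bregman R gR (A *v z) (A *v y) \<le> bregman R gR z y"
      "induced_norm N A \<le> 1"
    and delta: "0 < \<delta>" "\<delta> < 1"
  shows "measure M {\<omega> \<in> space M.
      dynamic_regret T (f \<omega>) (x \<omega>) (xs \<omega>)
        \<le> E_track N A \<eta> T L K rad (xs \<omega>) + E_net W \<eta> T L + E_stoch T L rad \<delta>} \<ge> 1 - \<delta>"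
proof -
  interpret prob_space M by (rule prob(1))
  have bregman_le: "bregman R gR z y \<le> rad\<^sup>2" if "z \<in> X" "y \<in> X" for z y
    unfolding radius(2) using that
    by (intro cSUP_upper2[OF bregman_bdd_above[OF norm domain(1) bregman_lipschitz], of "(z, y)"]) auto
  interpret dmd: distributed_mirror_descent X N R gR E W A \<eta> L K rad
  proof
    show "A *v z \<in> X" if "z \<in> X" for z using domain(4) that by blast
    show "W $ i $ j > 0" if "i \<noteq> j" "E i j" for i j using weights(2) that by blast
    show "N (A *v z) \<le> N z" for z by (rule norm_mult_le_of_induced_norm[OF norm non_expansive(2)])
  qed (fact norm domain(2,3) mirror_map bregman_le step_size graph(3) weights(1,3,4,5)
        separate_convexity bregman_lipschitz non_expansive(1))+
  let ?n = "real CARD('n)"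
  define h where "h i t \<omega> = x \<omega> i t - xs \<omega> t" for i t \<omega>
  \<comment> \<open>The true gradients need not be measurable in the sample point, so this function is identified with
    a measurable one only almost everywhere, in \<open>noise_eq\<close> below.\<close>
  define noise where "noise t \<omega> = 1 / ?n * (\<Sum>i\<in>UNIV. (gf \<omega> i t (x \<omega> i t) - g \<omega> i t) \<bullet> h i t \<omega>)" for t \<omega>
  define bound where "bound \<omega> = E_track N A \<eta> T L K rad (xs \<omega>) + E_net W \<eta> T L" for \<omega>
  let ?good = "{\<omega> \<in> space M. dynamic_regret T (f \<omega>) (x \<omega>) (xs \<omega>) \<le> bound \<omega> + E_stoch T L rad \<delta>}"

  have pathwise: "dynamic_regret T (f \<omega>) (x \<omega>) (xs \<omega>) \<le> bound \<omega> + (\<Sum>t=1..T. noise t \<omega>)"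
    if \<omega>: "\<omega> \<in> space M" and g: "\<forall>i\<in>UNIV. \<forall>t\<in>{1..T}. dual_norm N (g \<omega> i t) \<le> L" for \<omega>
    unfolding bound_def noise_def h_def
    using dmd.dynamic_regret_le[OF algorithm(1)[OF \<omega>], of "xs \<omega>" "f \<omega>" "gf \<omega>"]
      target(2) loss(1,2) lipschitz \<omega> g by blast
  have gradient_AE: "AE \<omega> in M. \<forall>i\<in>UNIV. \<forall>t\<in>{1..T}. dual_norm N (g \<omega> i t) \<le> L"
    by (intro AE_finite_allI stochastic_gradient(3)) auto
  have x_in: "x \<omega> i t \<in> X" and xs_in: "xs \<omega> t \<in> X" if "\<omega> \<in> space M" "t \<in> {1..T}" for \<omega> i t
    using dmd.estimate_in_domain[OF algorithm(1)[OF that(1)], of t i] target(2)[OF that(1), of t] that(2) by auto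

  \<comment> \<open>The measure of a set that is not measurable is \<open>0\<close> by convention, so measurability of the event is
    part of the claim. The losses enter it at random points.\<close>
  have good_meas: "?good \<in> sets M"
  proof -
    have NM: "N \<in> borel_measurable borel"
      by (rule borel_measurable_continuous_onI[OF is_norm_continuous[OF norm]])
    have AM: "(\<lambda>z. A *v z) \<in> borel_measurable borel"
      by (intro borel_measurable_continuous_onI linear_continuous_on matrix_vector_mul_bounded_linear)
    have xM: "(\<lambda>\<omega>. x \<omega> i t) \<in> borel_measurable M" if "t \<in> {1..T}" for i t
      by (rule measurable_from_subalg[OF prob(3) algorithm(2)[OF that]])
    have xsM: "(\<lambda>\<omega>. xs \<omega> t) \<in> borel_measurable M" if "t \<in> {1..T + 1}" for t
      by (rule measurable_from_subalg[OF prob(3) target(4)[OF that]])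
    have fM: "(\<lambda>\<omega>. f \<omega> i t (p \<omega>)) \<in> borel_measurable M"
      if "t \<in> {1..T}" "p \<in> borel_measurable M" "\<And>\<omega>. \<omega> \<in> space M \<Longrightarrow> p \<omega> \<in> X" for i t p
      by (rule borel_measurable_lipschitz_compose[OF is_norm_continuous[OF norm] is_norm_simps(1)[OF norm]
            is_norm_nonneg[OF norm] measurable_from_subalg[OF prob(3) loss(3)[OF that(1)]]
            lipschitz[OF _ that(1)] that(2,3)])
    have drift: "(\<lambda>\<omega>. N (xs \<omega> (t + 1) - A *v xs \<omega> t)) \<in> borel_measurable M" if "t \<in> {1..T}" for t
    proof -
      have 1: "(\<lambda>\<omega>. A *v xs \<omega> t) \<in> borel_measurable M"
        using xsM[of t] that by (intro measurable_compose[OF _ AM]) auto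
      have 2: "(\<lambda>\<omega>. xs \<omega> (t + 1)) \<in> borel_measurable M" using xsM[of "t + 1"] that by auto
      show ?thesis by (intro measurable_compose[OF _ NM] borel_measurable_diff 1 2)
    qed
    have "(\<lambda>\<omega>. dynamic_regret T (f \<omega>) (x \<omega>) (xs \<omega>)) \<in> borel_measurable M"
      unfolding dynamic_regret_def global_loss_def
      by (intro borel_measurable_diff borel_measurable_times borel_measurable_const borel_measurable_sum
          fM xM xsM x_in xs_in) auto
    moreover have "bound \<in> borel_measurable M"
      unfolding bound_def E_track_def
      by (intro borel_measurable_add borel_measurable_times borel_measurable_const borel_measurable_sum drift)
    ultimately show ?thesis by measurable
  qed

  have "1 - \<delta> \<le> prob ?good"
  proof (cases "T = 0")
    case True
    have "?good = space M" using pathwise True by (auto simp: E_stoch_def)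
    then show ?thesis using delta by (simp add: prob_space)
  next
    case False
    \<comment> \<open>A received gradient is what makes \<open>L\<close> nonnegative; without rounds there is none.\<close>
    then have "1 \<in> {1..T}" by simp
    from stochastic_gradient(3)[OF this, of undefined] have "AE \<omega> in M. 0 \<le> L"
      by eventually_elim (rule order_trans[OF dual_norm_nonneg[OF norm]])
    then have L: "0 \<le> L" by simp
    define c where "c = L * (sqrt 2 * rad)"
    have c: "0 \<le> c" using L radius(1) by (simp add: c_def)
    have h_le: "N (h i t \<omega>) \<le> sqrt 2 * rad" if "\<omega> \<in> space M" "t \<in> {1..T}" for i t \<omega>
    proof -
      have "(N (h i t \<omega>))\<^sup>2 \<le> 2 * rad\<^sup>2"
        using bregman_ge_half_square[OF mirror_map(2) x_in[OF that] xs_in[OF that], of i]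
          bregman_le[OF x_in[OF that] xs_in[OF that], of i] by (simp add: h_def)
      also have "\<dots> = (sqrt 2 * rad)\<^sup>2" by (simp add: power_mult_distrib)
      finally show ?thesis by (rule power2_le_imp_le) (use radius(1) in simp)
    qed
    define G where "G t \<omega> = 1 / ?n * (\<Sum>i\<in>UNIV. g \<omega> i t \<bullet> h i t \<omega>)" for t \<omega>
    have inner_le: "AE \<omega> in M. \<bar>g \<omega> i t \<bullet> h i t \<omega>\<bar> \<le> c" if t: "t \<in> {1..T}" for i t
      using stochastic_gradient(3)[OF t, of i] AE_space
    proof eventually_elim
      case (elim \<omega>)
      have "\<bar>g \<omega> i t \<bullet> h i t \<omega>\<bar> \<le> L * N (h i t \<omega>)" by (rule abs_inner_le_dual_norm[OF norm elim(1)])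
      also have "\<dots> \<le> c" unfolding c_def using h_le[OF elim(2) t] L by (intro mult_left_mono)
      finally show ?case .
    qed
    have h_meas: "h i t \<in> borel_measurable (F (t - 1))" if t: "t \<in> {1..T}" for i t
      unfolding h_def using target(4)[of t] t by (intro borel_measurable_diff algorithm(2)[OF t]) auto
    have gh_meas: "(\<lambda>\<omega>. g \<omega> i t \<bullet> h i t \<omega>) \<in> borel_measurable (F t)" if t: "t \<in> {1..T}" for i t
    proof -
      have "sets (F (t - 1)) \<subseteq> sets (F t)" "space (F (t - 1)) = space (F t)"
        using filtration.sets_F_mono[OF prob(2), of "t - 1" t] filtration.space_F[OF prob(2)] by auto
      then have "h i t \<in> borel_measurable (F t)" using h_meas[OF t, of i] by (auto simp: measurable_def)
      then show ?thesis using stochastic_gradient(1)[OF t, of i] by measurable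
    qed
    have G_meas: "G t \<in> borel_measurable (F t)" if t: "t \<in> {1..T}" for t
      unfolding G_def using gh_meas[OF t] by measurable
    have G_le: "AE \<omega> in M. \<bar>G t \<omega>\<bar> \<le> c" if t: "t \<in> {1..T}" for t
    proof -
      have "AE \<omega> in M. \<forall>i\<in>UNIV. \<bar>g \<omega> i t \<bullet> h i t \<omega>\<bar> \<le> c"
        by (intro AE_finite_allI inner_le[OF t]) auto
      then show ?thesis
      proof eventually_elim
        case (elim \<omega>)
        have "\<bar>\<Sum>i\<in>UNIV. g \<omega> i t \<bullet> h i t \<omega>\<bar> \<le> (\<Sum>i\<in>(UNIV :: 'n set). c)"
          using elim by (intro order_trans[OF sum_abs] sum_mono) auto
        then show ?case by (simp add: G_def abs_mult field_simps)
      qed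
    qed
    have noise_eq: "AE \<omega> in M. noise t \<omega> = real_cond_exp M (F (t - 1)) (G t) \<omega> - G t \<omega>"
      if t: "t \<in> {1..T}" for t
    proof -
      interpret sub: finite_measure_subalgebra M "F (t - 1)"
        by standard (rule prob(3))
      have hM [measurable]: "h i t \<in> borel_measurable M" for i
        by (rule measurable_from_subalg[OF prob(3) h_meas[OF t]])
      have gM [measurable]: "(\<lambda>\<omega>. g \<omega> i t) \<in> borel_measurable M" for i
        by (rule measurable_from_subalg[OF prob(3) stochastic_gradient(1)[OF t]])
      obtain B where B: "B > 0" "\<And>z. norm z \<le> B * N z" using euclidean_le_is_norm[OF norm] by blast
      have nth: "(\<lambda>z. z $ k) \<in> borel_measurable borel" for k :: 'd
        by (intro borel_measurable_continuous_onI continuous_intros)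
      have [measurable]: "(\<lambda>\<omega>. h i t \<omega> $ k) \<in> borel_measurable M" "(\<lambda>\<omega>. g \<omega> i t $ k) \<in> borel_measurable M" for i k
        by (rule measurable_compose[OF hM nth] measurable_compose[OF gM nth])+
      have int_k: "integrable M (\<lambda>\<omega>. h i t \<omega> $ k * g \<omega> i t $ k)" for i k
      proof (rule integrable_const_bound)
        show "AE \<omega> in M. norm (h i t \<omega> $ k * g \<omega> i t $ k) \<le> B * (sqrt 2 * rad) * (L * N (axis k 1))"
          using stochastic_gradient(3)[OF t, of i] AE_space
        proof eventually_elim
          case (elim \<omega>)
          have "\<bar>g \<omega> i t $ k\<bar> \<le> L * N (axis k 1)"
            using abs_inner_le_dual_norm[OF norm elim(1), of "axis k 1"] by (simp add: inner_axis)
          moreover have "\<bar>h i t \<omega> $ k\<bar> \<le> B * (sqrt 2 * rad)"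
            using component_le_norm_cart[of "h i t \<omega>" k] B(2)[of "h i t \<omega>"]
              mult_left_mono[OF h_le[OF elim(2) t, of i], of B] B(1) by linarith
          ultimately show ?case using B(1) radius(1) by (simp add: abs_mult mult_mono)
        qed
      qed measurable
      have int: "integrable M (\<lambda>\<omega>. g \<omega> i t \<bullet> h i t \<omega>)" for i
        using inner_le[OF t, of i] by (intro integrable_const_bound[of _ c]) auto
      have "AE \<omega> in M. real_cond_exp M (F (t - 1)) (\<lambda>\<omega>. g \<omega> i t \<bullet> h i t \<omega>) \<omega>
          = gf \<omega> i t (x \<omega> i t) \<bullet> h i t \<omega>" for i
        using sub.real_cond_exp_inner[OF h_meas[OF t, of i] gM[of i] int_k] stochastic_gradient(2)[OF t, of i]
        by eventually_elim simp
      then have "AE \<omega> in M. \<forall>i\<in>UNIV. real_cond_exp M (F (t - 1)) (\<lambda>\<omega>. g \<omega> i t \<bullet> h i t \<omega>) \<omega>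
          = gf \<omega> i t (x \<omega> i t) \<bullet> h i t \<omega>"
        by (intro AE_finite_allI) auto
      moreover have "AE \<omega> in M. real_cond_exp M (F (t - 1)) (\<lambda>\<omega>. \<Sum>i\<in>UNIV. g \<omega> i t \<bullet> h i t \<omega>) \<omega>
          = (\<Sum>i\<in>UNIV. real_cond_exp M (F (t - 1)) (\<lambda>\<omega>. g \<omega> i t \<bullet> h i t \<omega>) \<omega>)"
        using int by (rule sub.real_cond_exp_sum)
      moreover have "AE \<omega> in M. real_cond_exp M (F (t - 1)) (G t) \<omega>
          = 1 / ?n * real_cond_exp M (F (t - 1)) (\<lambda>\<omega>. \<Sum>i\<in>UNIV. g \<omega> i t \<bullet> h i t \<omega>) \<omega>"
        unfolding G_def using int by (intro sub.real_cond_exp_cmult) auto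
      ultimately show ?thesis
        by eventually_elim
          (simp add: noise_def G_def inner_diff_left sum_subtractf diff_divide_distrib)
    qed
    let ?\<epsilon> = "2 * c * sqrt (- 2 * real T * ln \<delta>)"
    have eps: "?\<epsilon> \<le> E_stoch T L rad \<delta>"
    proof -
      have "sqrt (- 2 * real T * ln \<delta>) = sqrt 2 * sqrt (- real T * ln \<delta>)"
        by (simp flip: real_sqrt_mult)
      then have "?\<epsilon> = 2 * (sqrt 2 * sqrt 2) * L * rad * sqrt (- real T * ln \<delta>)"
        unfolding c_def by (simp only: mult_ac)
      also have "\<dots> = 4 * L * rad * sqrt (- real T * ln \<delta>)" by simp
      also have "\<dots> \<le> 8 * L * rad * sqrt (- real T * ln \<delta>)"
        using L radius(1) delta by (intro mult_right_mono) (auto intro: mult_nonneg_nonpos)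
      finally show ?thesis by (simp add: E_stoch_def)
    qed
    have noise_AE: "AE \<omega> in M. \<forall>t\<in>{1..T}. noise t \<omega> = real_cond_exp M (F (t - 1)) (G t) \<omega> - G t \<omega>"
      by (intro AE_finite_allI noise_eq) auto
    have "1 - \<delta> \<le> prob {\<omega> \<in> space M.
        (\<Sum>t=1..T. real_cond_exp M (F (t - 1)) (G t) \<omega> - G t \<omega>) \<le> ?\<epsilon>}"
      by (rule azuma_centred_quantile[OF prob(2,3) G_meas G_le c delta])
    also have "\<dots> \<le> prob ?good"
    proof (rule finite_measure_mono_AE[OF _ good_meas])
      show "AE \<omega> in M. \<omega> \<in> {\<omega> \<in> space M.
          (\<Sum>t=1..T. real_cond_exp M (F (t - 1)) (G t) \<omega> - G t \<omega>) \<le> ?\<epsilon>} \<longrightarrow> \<omega> \<in> ?good"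
        using gradient_AE noise_AE
      proof eventually_elim
        case (elim \<omega>)
        have noise_sum: "(\<Sum>t=1..T. noise t \<omega>)
            = (\<Sum>t=1..T. real_cond_exp M (F (t - 1)) (G t) \<omega> - G t \<omega>)"
          using elim(2) by (intro sum.cong) auto
        show ?case
        proof
          assume "\<omega> \<in> {\<omega> \<in> space M.
            (\<Sum>t=1..T. real_cond_exp M (F (t - 1)) (G t) \<omega> - G t \<omega>) \<le> ?\<epsilon>}"
          then have \<omega>: "\<omega> \<in> space M" "(\<Sum>t=1..T. noise t \<omega>) \<le> ?\<epsilon>"
            unfolding noise_sum by simp_all
          then show "\<omega> \<in> ?good"
            using pathwise[OF \<omega>(1) elim(1)] eps by (intro CollectI conjI) linarith+
        qed
      qed
    qed
    finally show ?thesis .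
  qed
  then show ?thesis by (simp add: bound_def)
qed

end
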